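(* Let $p\in(1,\infty)$, $m\in\mathbb{N}$, and let $f$ be a function defined on a closed set $E\subset\mathbb{R}$ with $\#E>m$. Then $f\in L^m_p(\mathbb{R})|_E$ if and only if $(\Delta^mf)^\sharp_E\in L_p(\mathbb{R})$. Furthermore, $$\|f\|_{L^m_p(\mathbb{R})|_E}\sim\|(\Delta^mf)^\sharp_E\|_{L_p(\mathbb{R})}$$ with constants in this equivalence depending only on $m$ and $p$ (i.e. each side is at most $C$ times the other, with $C\ge1$ depending only on $m$ and $p$).
   Context: $L^m_p(\mathbb{R})$ is the homogeneous Sobolev space of functions $F:\mathbb{R}\to\mathbb{R}$ such that $F^{(m-1)}$ exists and is (locally) absolutely continuous and $F^{(m)}\in L_p(\mathbb{R})$, seminormed by $\|F\|_{L^m_p(\mathbb{R})}=\|F^{(m)}\|_{L_p(\mathbb{R})}$. The trace space is $L^m_p(\mathbb{R})|_E=\{f:E\to\mathbb{R}:\exists F\in L^m_p(\mathbb{R}),\ F|_E=f\}$ with trace seminorm $\|f\|_{L^m_p(\mathbb{R})|_E}=\inf\{\|F\|_{L^m_p(\mathbb{R})}:F\in L^m_p(\mathbb{R}),\,F|_E=f\}$. For a $(k+1)$-point set $S\subset\mathbb{R}$, $\Delta^kf[S]$ denotes the $k$-th order divided difference: the coefficient of $x^k$ in the Lagrange polynomial of degree at most $k$ which agrees with $f$ on $S$. The sharp maximal function is $$(\Delta^mf)^\sharp_E(x)=\sup_{\{x_0,\dots,x_m\}\subset E,\ x_0<x_1<\dots<x_m}\frac{|\Delta^{m-1}f[x_0,\dots,x_{m-1}]-\Delta^{m-1}f[x_1,\dots,x_m]|}{|x-x_0|+|x-x_m|},\qquad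 x\in\mathbb{R}.$$ *)

theory Defs
  imports "HOL-Analysis.Analysis" "HOL-Computational_Algebra.Polynomial"
begin

text \<open>
  Absolute continuity on a set of reals, in the usual form with finite families of
  non-overlapping intervals. The elements of a division are nonempty compact intervals with
  pairwise disjoint interiors, so \<open>Inf K\<close> and \<open>Sup K\<close> are the endpoints of \<open>K\<close>.
\<close>

definition absolutely_continuous_on :: "real set \<Rightarrow> (real \<Rightarrow> real) \<Rightarrow> bool" where
  "absolutely_continuous_on S g \<longleftrightarrow>
     (\<forall>\<epsilon>>0. \<exists>\<delta>>0. \<forall>D T. D division_of T \<longrightarrow> T \<subseteq> S \<longrightarrow>
        (\<Sum>K\<in>D. Sup K - Inf K) < \<delta> \<longrightarrow> (\<Sum>K\<in>D. \<bar>g (Sup K) - g (Inf K)\<bar>) < \<epsilon>)"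

definition locally_absolutely_continuous :: "(real \<Rightarrow> real) \<Rightarrow> bool" where
  "locally_absolutely_continuous g \<longleftrightarrow> (\<forall>a b. absolutely_continuous_on {a..b} g)"

text \<open>
  The sharp maximal function may take the value \<open>\<infinity>\<close>, so the spaces \<open>L\<^sub>p\<close> are set up for
  functions with values in \<^typ>\<open>ennreal\<close>; a real function \<open>g\<close> enters through \<open>\<bar>g\<bar>\<close>.
  Only exponents \<open>p > 0\<close> are used.
\<close>

definition ennpow :: "ennreal \<Rightarrow> real \<Rightarrow> ennreal" where
  "ennpow x p = (if x = \<infinity> then \<infinity> else ennreal (enn2real x powr p))"

definition Lp_norm :: "real \<Rightarrow> (real \<Rightarrow> ennreal) \<Rightarrow> ennreal" where
  "Lp_norm p g = ennpow (\<integral>\<^sup>+ x. ennpow (g x) p \<partial>lebesgue) (1 / p)"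

definition in_Lp :: "real \<Rightarrow> (real \<Rightarrow> ennreal) \<Rightarrow> bool" where
  "in_Lp p g \<longleftrightarrow> g \<in> borel_measurable lebesgue \<and> Lp_norm p g < \<infinity>"

definition in_Lp_real :: "real \<Rightarrow> (real \<Rightarrow> real) \<Rightarrow> bool" where
  "in_Lp_real p g \<longleftrightarrow> g \<in> borel_measurable lebesgue \<and> Lp_norm p (\<lambda>x. ennreal \<bar>g x\<bar>) < \<infinity>"

text \<open>
  The homogeneous Sobolev space \<open>L\<^sup>m\<^sub>p(\<real>)\<close>, for \<open>m \<ge> 1\<close>. Since the derivative of order \<open>m - 1\<close>
  is locally absolutely continuous, \<open>(deriv ^^ m) F x\<close> is the \<open>m\<close>-th derivative for almost
  every \<open>x\<close>; on the exceptional null set it is unspecified, which affects neither Lebesgue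
  measurability nor the norm.
\<close>

definition sobolev :: "nat \<Rightarrow> real \<Rightarrow> (real \<Rightarrow> real) set" where
  "sobolev m p = {F.
     (\<forall>k<m - 1. \<forall>x. (deriv ^^ k) F field_differentiable at x) \<and>
     locally_absolutely_continuous ((deriv ^^ (m - 1)) F) \<and>
     in_Lp_real p ((deriv ^^ m) F)}"

definition sobolev_seminorm :: "nat \<Rightarrow> real \<Rightarrow> (real \<Rightarrow> real) \<Rightarrow> ennreal" where
  "sobolev_seminorm m p F = Lp_norm p (\<lambda>x. ennreal \<bar>(deriv ^^ m) F x\<bar>)"

text \<open>
  Functions on \<open>E\<close> are represented by functions on \<open>\<real>\<close> whose values outside \<open>E\<close> are irrelevant.
\<close>

definition trace_space :: "nat \<Rightarrow> real \<Rightarrow> real set \<Rightarrow> (real \<Rightarrow> real) set" where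
  "trace_space m p E = {f. \<exists>F\<in>sobolev m p. \<forall>x\<in>E. F x = f x}"

definition trace_seminorm :: "nat \<Rightarrow> real \<Rightarrow> real set \<Rightarrow> (real \<Rightarrow> real) \<Rightarrow> ennreal" where
  "trace_seminorm m p E f =
     (INF F\<in>{F \<in> sobolev m p. \<forall>x\<in>E. F x = f x}. sobolev_seminorm m p F)"

definition lagrange_poly :: "nat \<Rightarrow> (real \<Rightarrow> real) \<Rightarrow> real set \<Rightarrow> real poly" where
  "lagrange_poly k f S = (THE q. degree q \<le> k \<and> (\<forall>x\<in>S. poly q x = f x))"

lemma lagrange_poly_ex1:
  fixes f :: "real \<Rightarrow> real"
  assumes "card S = Suc k"
  shows "\<exists>!q. degree q \<le> k \<and> (\<forall>x\<in>S. poly q x = f x)"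
proof (rule ex_ex1I)
  have "\<exists>q. degree q \<le> card S - 1 \<and> (\<forall>x\<in>S. poly q x = f x)" if "finite S" for S
    using that
  proof induction
    case empty
    show ?case by (rule exI[of _ 0]) simp
  next
    case (insert a S)
    then obtain q where q: "degree q \<le> card S - 1" "\<forall>x\<in>S. poly q x = f x" by blast
    let ?w = "\<Prod>y\<in>S. [:-y, 1:]"
    let ?r = "q + smult ((f a - poly q a) / poly ?w a) ?w"
    have "poly ?w a \<noteq> 0" using insert by (simp add: poly_prod)
    moreover have "poly ?w x = 0" if "x \<in> S" for x
      using that insert by (auto simp: poly_prod)
    moreover have "degree ?w \<le> card S"
      using degree_prod_sum_le[OF insert(1), of "\<lambda>y. [:-y, 1:]"] by simp
    then have "degree ?r \<le> card S"
      using q(1) by (intro degree_add_le) (auto intro: order.trans[OF degree_smult_le])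
    ultimately show ?case
      using q insert by (intro exI[of _ ?r]) auto
  qed
  then show "\<exists>q. degree q \<le> k \<and> (\<forall>x\<in>S. poly q x = f x)"
    using assms by (metis card.infinite diff_Suc_1 nat.distinct(1))
next
  fix q r
  assume "degree q \<le> k \<and> (\<forall>x\<in>S. poly q x = f x)" "degree r \<le> k \<and> (\<forall>x\<in>S. poly r x = f x)"
  then show "q = r"
    using assms by (intro poly_eqI_degree[of S]) auto
qed

text \<open>The divided difference \<open>\<Delta>\<^sup>k f[S]\<close> of order \<open>k\<close>, for \<open>card S = k + 1\<close>.\<close>

definition divided_diff :: "nat \<Rightarrow> (real \<Rightarrow> real) \<Rightarrow> real set \<Rightarrow> real" where
  "divided_diff k f S = coeff (lagrange_poly k f S) k"

definition sharp_maximal :: "nat \<Rightarrow> real set \<Rightarrow> (real \<Rightarrow> real) \<Rightarrow> real \<Rightarrow> ennreal" where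
  "sharp_maximal m E f x =
     (SUP t\<in>{t :: nat \<Rightarrow> real. strict_mono_on {0..m} t \<and> t ` {0..m} \<subseteq> E}.
        ennreal (\<bar>divided_diff (m - 1) f (t ` {0..m - 1}) - divided_diff (m - 1) f (t ` {1..m})\<bar>
                 / (\<bar>x - t 0\<bar> + \<bar>x - t m\<bar>)))"

end

theory Submission
  imports Defs
begin

text \<open>
  Necessity. Let \<open>F\<close> be a Sobolev function and \<open>x\<^sub>0 < \<dots> < x\<^sub>m\<close>. By the mean value theorem for divided
  differences, the difference of the two divided differences of order \<open>m - 1\<close> is at most the integral of
  \<open>\<bar>F\<^sup>(\<^sup>m\<^sup>)\<bar>\<close> over \<open>[x\<^sub>0, x\<^sub>m]\<close>. This interval lies in \<open>[x - r, x + r]\<close> with \<open>r = \<bar>x - x\<^sub>0\<bar> + \<bar>x - x\<^sub>m\<bar>\<close>, so the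
  sharp maximal function is at most twice the Hardy--Littlewood maximal function of \<open>F\<^sup>(\<^sup>m\<^sup>)\<close>.

  Sufficiency. On a finite set \<open>x\<^sub>0 < \<dots> < x\<^sub>n\<close> interpolate as de Boor does: start from the polynomial through
  the first \<open>m\<close> points and, for each further point \<open>x\<^sub>i\<^sub>+\<^sub>m\<close>, add a multiple of
  \<open>(y - x\<^sub>i\<^sub>+\<^sub>1) \<cdots> (y - x\<^sub>i\<^sub>+\<^sub>m\<^sub>-\<^sub>1)\<close> times a smooth step across the largest gap of \<open>[x\<^sub>i, x\<^sub>i\<^sub>+\<^sub>m]\<close>. The coefficient is
  exactly a difference of two consecutive divided differences, which gives the pointwise bound
  \<open>\<bar>F\<^sup>(\<^sup>m\<^sup>)\<bar> \<le> C (\<Delta>\<^sup>m f)\<^sup>\<sharp>\<close> with \<open>C\<close> depending only on \<open>m\<close>. The resulting bound on the increments of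
  \<open>F\<^sup>(\<^sup>m\<^sup>-\<^sup>1\<^sup>)\<close> is preserved under pointwise limits, so Tychonoff's theorem yields an extension from all of
  \<open>E\<close>, and Lebesgue differentiation bounds its \<open>m\<close>-th derivative almost everywhere.
\<close>

section \<open>Differentiation of absolutely continuous functions\<close>

text \<open>Absolute continuity is given by epsilon and delta, so the identity g(b) - g(a) =
  integral of g', on which necessity rests, has to be derived: g is a difference of two monotone
  absolutely continuous functions, each of these has a density, and Lebesgue differentiation
  identifies the density with g'. In the passage to the limit, a pointwise bound on derivatives of
  order m is not a closed condition, whereas \<open>\<bar>g b - g a\<bar> \<le> H b - H a\<close>
  is. One \<open>H\<close>, a primitive of a multiple of the sharp function, serves all finite
  subsets, because the sharp function is always taken over the whole of E. The constant depends only
  on m for two reasons: the largest of m gaps has at least the m-th part of the total length, so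
  rescaling a fixed step to it costs only powers of m; and at most m + 1 of the intervals
  [x_i, x_(i+m)] contain a given point. The condition p > 1 makes t^(p-2) integrable at 0 in the
  maximal inequality, and it makes A^(1-p) tend to 0 in the splitting h <= A + A^(1-p) h^p, from
  which local absolute continuity of the extension is read off.\<close>

definition var_sum :: "(real \<Rightarrow> real) \<Rightarrow> nat \<Rightarrow> (nat \<Rightarrow> real) \<Rightarrow> real" where
  "var_sum g n t = (\<Sum>i<n. \<bar>g (t (Suc i)) - g (t i)\<bar>)"

text \<open>Weakly monotone sequences on all naturals stay in the class under truncation by
  \<open>min\<close> and \<open>max\<close> and when a tail is replaced by larger values in the
  interval. For \<open>b < a\<close> the set is empty.\<close>

definition var_sums :: "(real \<Rightarrow> real) \<Rightarrow> real \<Rightarrow> real \<Rightarrow> real set" where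
  "var_sums g a b = {var_sum g n t | n t. mono t \<and> range t \<subseteq> {a..b}}"

definition variation :: "(real \<Rightarrow> real) \<Rightarrow> real \<Rightarrow> real \<Rightarrow> real" where
  "variation g a b = Sup (var_sums g a b)"

section \<open>Variation of absolutely continuous functions\<close>

lemma absolutely_continuous_onD:
  assumes "absolutely_continuous_on S g" "0 < e"
  obtains d where "0 < d" "\<And>D T. D division_of T \<Longrightarrow> T \<subseteq> S \<Longrightarrow>
        (\<Sum>K\<in>D. Sup K - Inf K) < d \<Longrightarrow> (\<Sum>K\<in>D. \<bar>g (Sup K) - g (Inf K)\<bar>) < e"
  using assms unfolding absolutely_continuous_on_def by meson

lemma absolutely_continuous_on_subset:
  "absolutely_continuous_on S g \<Longrightarrow> T \<subseteq> S \<Longrightarrow> absolutely_continuous_on T g"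
  unfolding absolutely_continuous_on_def by (meson subset_trans)

lemma division_of_real_intervalE:
  assumes "D division_of T" "K \<in> D"
  obtains c d :: real where "K = {c..d}" "c \<le> d"
  using division_ofD(3,4)[OF assms] by (metis atLeastatMost_empty_iff box_real(2) linear)

text \<open>This turns control of increments into control of variation sums: the steps of all chains
  \<open>t K\<close> together form a division of no greater total length, to which the definition of
  absolute continuity applies.\<close>

lemma division_refine:
  fixes D :: "real set set" and g :: "real \<Rightarrow> real"
  assumes D: "D division_of T"
    and t: "\<And>K. K \<in> D \<Longrightarrow> mono (t K)" "\<And>K. K \<in> D \<Longrightarrow> range (t K) \<subseteq> K"
  obtains D' T' where "D' division_of T'" "T' \<subseteq> T"
    "(\<Sum>K\<in>D'. Sup K - Inf K) \<le> (\<Sum>K\<in>D. Sup K - Inf K)"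
    "(\<Sum>K\<in>D'. \<bar>g (Sup K) - g (Inf K)\<bar>) = (\<Sum>K\<in>D. var_sum g (n K) (t K))"
proof -
  \<comment> \<open>Steps of length zero are left out; they contribute nothing. The remaining
    intervals have nonempty interior, so disjointness of the interiors makes \<open>\<iota>\<close>
    injective and sums over its image can be reindexed.\<close>
  define J where "J = (SIGMA K:D. {i. i < n K \<and> t K i < t K (Suc i)})"
  define \<iota> where "\<iota> = (\<lambda>(K, i). {t K i..t K (Suc i)})"
  have finD: "finite D" using D by blast
  then have finJ: "finite J"
    unfolding J_def by auto
  have JD: "K \<in> D" "i < n K" "t K i < t K (Suc i)" if "(K, i) \<in> J" for K i
    using that by (auto simp: J_def)
  have sub: "\<iota> (K, i) \<subseteq> K" if Ki: "(K, i) \<in> J" for K i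
  proof -
    obtain c d where "K = {c..d}" using division_of_real_intervalE[OF D JD(1)[OF Ki]] by blast
    moreover have "t K i \<in> K" "t K (Suc i) \<in> K" using t(2)[OF JD(1)[OF Ki]] by auto
    ultimately show ?thesis by (auto simp: \<iota>_def)
  qed
  have disj: "interior (\<iota> p) \<inter> interior (\<iota> q) = {}" if "p \<in> J" "q \<in> J" "p \<noteq> q" for p q
  proof -
    obtain K i L j where p: "p = (K, i)" "q = (L, j)" by (metis surj_pair)
    show ?thesis
    proof (cases "K = L")
      case True
      then have "i \<noteq> j" using that p by auto
      moreover have "t K (Suc i) \<le> t K j" if "i < j" for i j
        using t(1)[of K] JD(1) \<open>p \<in> J\<close> that unfolding p by (auto intro: monoD)
      ultimately have "t K (Suc i) \<le> t K j \<or> t K (Suc j) \<le> t K i" by (meson linorder_neqE_nat)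
      then show ?thesis using True by (auto simp: p \<iota>_def)
    next
      case False
      then have "interior K \<inter> interior L = {}"
        using division_ofD(5)[OF D] JD that unfolding p by meson
      then show ?thesis
        using sub[of K i] sub[of L j] that interior_mono unfolding p by blast
    qed
  qed
  have ne: "interior (\<iota> p) \<noteq> {}" if "p \<in> J" for p
    using that by (auto simp: J_def \<iota>_def)
  have inj: "inj_on \<iota> J"
    by (rule inj_onI) (metis disj ne Int_absorb)
  have SI: "Sup (\<iota> (K, i)) = t K (Suc i)" "Inf (\<iota> (K, i)) = t K i" if "(K, i) \<in> J" for K i
    using JD(3)[OF that] by (auto simp: \<iota>_def)
  have div: "(\<iota> ` J) division_of (\<Union>(\<iota> ` J))"
  proof (rule division_ofI)
    show "finite (\<iota> ` J)" using finJ by simp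
    fix X assume X: "X \<in> \<iota> ` J"
    then show "X \<noteq> {}" using ne by force
    show "\<exists>a b. X = cbox a b" using X by (auto simp: \<iota>_def)
    fix Y assume "Y \<in> \<iota> ` J" "X \<noteq> Y"
    then show "interior X \<inter> interior Y = {}" using X disj by blast
  qed auto
  show ?thesis
  proof (rule that[OF div])
    show "\<Union>(\<iota> ` J) \<subseteq> T"
      using sub JD(1) division_ofD(2)[OF D] by fast
    have "(\<Sum>K\<in>\<iota> ` J. Sup K - Inf K) = (\<Sum>p\<in>J. Sup (\<iota> p) - Inf (\<iota> p))"
      using inj by (simp add: sum.reindex)
    also have "\<dots> = (\<Sum>(K, i)\<in>J. t K (Suc i) - t K i)"
      by (rule sum.cong) (auto simp: SI)
    also have "\<dots> = (\<Sum>K\<in>D. \<Sum>i\<in>{i. i < n K \<and> t K i < t K (Suc i)}. t K (Suc i) - t K i)"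
      unfolding J_def by (subst sum.Sigma) (use finD in auto)
    also have "\<dots> \<le> (\<Sum>K\<in>D. Sup K - Inf K)"
    proof (rule sum_mono)
      fix K assume K: "K \<in> D"
      then obtain c d where cd: "K = {c..d}" "c \<le> d" using D division_of_real_intervalE by blast
      have "(\<Sum>i\<in>{i. i < n K \<and> t K i < t K (Suc i)}. t K (Suc i) - t K i) \<le> (\<Sum>i<n K. t K (Suc i) - t K i)"
        by (rule sum_mono2) (use t(1)[OF K] in \<open>auto simp: mono_iff_le_Suc\<close>)
      also have "\<dots> = t K (n K) - t K 0"
        by (simp add: sum_lessThan_telescope)
      also have "\<dots> \<le> d - c"
        using t(2)[OF K] cd by (smt (verit, best) atLeastAtMost_iff rangeI subsetD)
      finally show "(\<Sum>i\<in>{i. i < n K \<and> t K i < t K (Suc i)}. t K (Suc i) - t K i) \<le> Sup K - Inf K"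
        using cd by simp
    qed
    finally show "(\<Sum>K\<in>\<iota> ` J. Sup K - Inf K) \<le> (\<Sum>K\<in>D. Sup K - Inf K)" .
    have "(\<Sum>K\<in>\<iota> ` J. \<bar>g (Sup K) - g (Inf K)\<bar>) = (\<Sum>p\<in>J. \<bar>g (Sup (\<iota> p)) - g (Inf (\<iota> p))\<bar>)"
      using inj by (simp add: sum.reindex)
    also have "\<dots> = (\<Sum>(K, i)\<in>J. \<bar>g (t K (Suc i)) - g (t K i)\<bar>)"
      by (rule sum.cong) (auto simp: SI)
    also have "\<dots> = (\<Sum>K\<in>D. \<Sum>i\<in>{i. i < n K \<and> t K i < t K (Suc i)}. \<bar>g (t K (Suc i)) - g (t K i)\<bar>)"
      unfolding J_def by (subst sum.Sigma) (use finD in auto)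
    also have "\<dots> = (\<Sum>K\<in>D. var_sum g (n K) (t K))"
    proof (rule sum.cong[OF refl])
      fix K assume K: "K \<in> D"
      have "t K i = t K (Suc i)" if "\<not> t K i < t K (Suc i)" for i
        using t(1)[OF K] that by (metis antisym_conv2 le_SucI mono_iff_le_Suc)
      then have "\<forall>i\<in>{..<n K} - {i. i < n K \<and> t K i < t K (Suc i)}. \<bar>g (t K (Suc i)) - g (t K i)\<bar> = 0"
        by (metis (mono_tags, lifting) DiffE abs_0 cancel_comm_monoid_add_class.diff_cancel lessThan_iff mem_Collect_eq)
      then show "(\<Sum>i\<in>{i. i < n K \<and> t K i < t K (Suc i)}. \<bar>g (t K (Suc i)) - g (t K i)\<bar>) = var_sum g (n K) (t K)"
        unfolding var_sum_def by (intro sum.mono_neutral_left) auto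
    qed
    finally show "(\<Sum>K\<in>\<iota> ` J. \<bar>g (Sup K) - g (Inf K)\<bar>) = (\<Sum>K\<in>D. var_sum g (n K) (t K))" .
  qed
qed

lemma var_sum_split:
  fixes u :: real
  shows "var_sum g n t \<le> var_sum g n (\<lambda>i. min (t i) u) + var_sum g n (\<lambda>i. max (t i) u)"
  unfolding var_sum_def sum.distrib[symmetric]
  by (rule sum_mono) (auto simp: min_def max_def)

lemma var_sum_in: "mono t \<Longrightarrow> range t \<subseteq> {a..b} \<Longrightarrow> var_sum g n t \<in> var_sums g a b"
  unfolding var_sums_def by auto

lemma var_sums_le: "x \<in> var_sums g a b \<Longrightarrow> a \<le> b"
  unfolding var_sums_def by (force simp: image_subset_iff)

lemma var_sums_ne: "a \<le> b \<Longrightarrow> 0 \<in> var_sums g a b"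
  using var_sum_in[of "\<lambda>_. a" a b g 0] by (auto simp: var_sum_def mono_def)

lemma var_sums_split:
  assumes "x \<in> var_sums g a c" "a \<le> u" "u \<le> c"
  obtains y z where "y \<in> var_sums g a u" "z \<in> var_sums g u c" "x \<le> y + z"
proof -
  obtain n t where t: "x = var_sum g n t" "mono t" "range t \<subseteq> {a..c}"
    using assms unfolding var_sums_def by auto
  then have le: "a \<le> t i" "t i \<le> c" for i by (auto simp: image_subset_iff)
  show ?thesis
  proof (rule that)
    show "var_sum g n (\<lambda>i. min (t i) u) \<in> var_sums g a u"
      using t assms le by (intro var_sum_in) (auto simp: mono_def min.coboundedI1 image_subset_iff)
    show "var_sum g n (\<lambda>i. max (t i) u) \<in> var_sums g u c"
      using t assms le by (intro var_sum_in) (auto simp: mono_def max.coboundedI1 image_subset_iff)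
    show "x \<le> var_sum g n (\<lambda>i. min (t i) u) + var_sum g n (\<lambda>i. max (t i) u)"
      using var_sum_split t by simp
  qed
qed

text \<open>Absolute continuity with epsilon equal to 1 bounds every variation sum over an interval
  shorter than \<open>d\<close> by 1, and an interval shorter than \<open>N * d\<close> splits into
  \<open>N\<close> such pieces.\<close>

lemma absolutely_continuous_on_bdd_var_sums:
  assumes ac: "absolutely_continuous_on {a..b} g"
  shows "bdd_above (var_sums g a b)"
proof -
  obtain d where d: "0 < d" "\<And>D T. D division_of T \<Longrightarrow> T \<subseteq> {a..b} \<Longrightarrow>
        (\<Sum>K\<in>D. Sup K - Inf K) < d \<Longrightarrow> (\<Sum>K\<in>D. \<bar>g (Sup K) - g (Inf K)\<bar>) < 1"
    using absolutely_continuous_onD[OF ac zero_less_one] by metis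
  have short: "x \<le> 1" if x: "x \<in> var_sums g u v" and uv: "a \<le> u" "v \<le> b" "v - u < d" for u v x
  proof -
    obtain n t where t: "x = var_sum g n t" "mono t" "range t \<subseteq> {u..v}"
      using x unfolding var_sums_def by auto
    then have "u \<le> v" by (metis atLeastAtMost_iff order_trans range_subsetD)
    then have div: "{{u..v}} division_of {u..v}" using division_of_self[of u v] by simp
    obtain D' T' where "D' division_of T'" "T' \<subseteq> {u..v}"
      "(\<Sum>K\<in>D'. Sup K - Inf K) \<le> (\<Sum>K\<in>{{u..v}}. Sup K - Inf K)"
      "(\<Sum>K\<in>D'. \<bar>g (Sup K) - g (Inf K)\<bar>) = (\<Sum>K\<in>{{u..v}}. var_sum g n t)"
      by (rule division_refine[OF div, of "\<lambda>_. t" g "\<lambda>_. n"]) (use t in auto)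
    moreover from this uv have "T' \<subseteq> {a..b}" by fastforce
    ultimately show ?thesis
      using d(2)[of D' T'] t(1) uv \<open>u \<le> v\<close> by simp
  qed
  have "\<forall>x\<in>var_sums g u b. x \<le> real N" if "a \<le> u" "b - u < real N * d" for u N
    using that
  proof (induction N arbitrary: u)
    case 0
    then show ?case using var_sums_le by fastforce
  next
    case (Suc N)
    show ?case
    proof
      fix x assume x: "x \<in> var_sums g u b"
      then have "u \<le> b" by (rule var_sums_le)
      show "x \<le> real (Suc N)"
      proof (cases "b - u < d")
        case True
        then show ?thesis using short[OF x Suc.prems(1)] by simp
      next
        case False
        \<comment> \<open>A first piece of length exactly \<open>d\<close> would miss the strict
          inequality. Moving the cut back by half the slack \<open>e\<close> leaves the first piece
          shorter than \<open>d\<close> and the rest shorter than \<open>N * d\<close>.\<close>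
        define e where "e = min d (real (Suc N) * d - (b - u))"
        have e: "0 < e" "e \<le> d" "e \<le> real (Suc N) * d - (b - u)"
          using Suc.prems d(1) by (auto simp: e_def)
        define w where "w = u + d - e / 2"
        have w: "u \<le> w" "w \<le> b" "w - u < d" "b - w < real N * d"
          using e False by (auto simp: w_def algebra_simps)
        obtain y z where yz: "y \<in> var_sums g u w" "z \<in> var_sums g w b" "x \<le> y + z"
          using var_sums_split[OF x w(1,2)] by blast
        have "y \<le> 1" using short[OF yz(1)] Suc.prems w by simp
        moreover have "z \<le> N" using Suc.IH[of w] Suc.prems w yz(2) by simp
        ultimately show ?thesis using yz by simp
      qed
    qed
  qed
  moreover obtain N where "(b - a) / d < real N" using reals_Archimedean2 by blast
  then have "b - a < real N * d" using d(1) by (simp add: field_simps)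
  ultimately show ?thesis unfolding bdd_above_def by (metis order_refl)
qed

lemma abs_diff_le_variation_diff:
  assumes bdd: "bdd_above (var_sums g a y)" and xy: "a \<le> x" "x \<le> y"
  shows "\<bar>g y - g x\<bar> \<le> variation g a y - variation g a x"
proof -
  have "s \<le> variation g a y - \<bar>g y - g x\<bar>" if s: "s \<in> var_sums g a x" for s
  proof -
    obtain n t where t: "s = var_sum g n t" "mono t" "range t \<subseteq> {a..x}"
      using s unfolding var_sums_def by auto
    \<comment> \<open>Appending \<open>x\<close> and then \<open>y\<close> to a chain that ends at
      or before \<open>x\<close> adds at least the increment from \<open>x\<close> to
      \<open>y\<close> to its variation sum.\<close>
    define t' where "t' i = (if i \<le> n then t i else if i = Suc n then x else y)" for i
    have le: "t i \<le> x" "a \<le> t i" for i using t(3) by (auto simp: image_subset_iff)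
    have "mono t'"
      unfolding mono_iff_le_Suc t'_def using t(2) le xy by (auto simp: mono_iff_le_Suc)
    moreover have "range t' \<subseteq> {a..y}" using le(2) order_trans[OF le(1) xy(2)] xy by (auto simp: t'_def)
    ultimately have "var_sum g (Suc (Suc n)) t' \<le> variation g a y"
      unfolding variation_def by (intro cSup_upper bdd var_sum_in)
    moreover have "var_sum g (Suc (Suc n)) t' = s + \<bar>g x - g (t n)\<bar> + \<bar>g y - g x\<bar>"
      unfolding var_sum_def t(1) by (simp add: t'_def)
    ultimately show ?thesis by linarith
  qed
  then have "variation g a x \<le> variation g a y - \<bar>g y - g x\<bar>"
    unfolding variation_def[of g a x] using var_sums_ne[OF xy(1)] by (intro cSup_least) auto
  then show ?thesis by simp
qed

lemma variation_split_le:
  assumes bdd: "bdd_above (var_sums g a x)" "bdd_above (var_sums g x y)" and xy: "a \<le> x" "x \<le> y"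
  shows "variation g a y \<le> variation g a x + variation g x y"
  unfolding variation_def[of g a y]
proof (rule cSup_least)
  show "var_sums g a y \<noteq> {}" using var_sums_ne[of a y] xy by force
  fix s assume "s \<in> var_sums g a y"
  then obtain p q where pq: "p \<in> var_sums g a x" "q \<in> var_sums g x y" "s \<le> p + q"
    using var_sums_split xy by blast
  then show "s \<le> variation g a x + variation g x y"
    unfolding variation_def using cSup_upper[OF pq(1) bdd(1)] cSup_upper[OF pq(2) bdd(2)] by linarith
qed

text \<open>An increment of the variation over an interval is, up to \<open>\<eta>\<close>, a
  variation sum of \<open>g\<close> inside that interval. Refining the division by these chains
  reduces the claim to the absolute continuity of \<open>g\<close>.\<close>

lemma absolutely_continuous_on_variation:
  assumes ac: "absolutely_continuous_on {a..b} g"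
  shows "absolutely_continuous_on {a..b} (variation g a)"
  unfolding absolutely_continuous_on_def
proof (intro allI impI)
  fix e :: real assume "e > 0"
  have bdd: "bdd_above (var_sums g u v)" if "a \<le> u" "v \<le> b" for u v
    by (rule absolutely_continuous_on_bdd_var_sums, rule absolutely_continuous_on_subset[OF ac]) (use that in auto)
  obtain d where d: "0 < d" "\<And>D T. D division_of T \<Longrightarrow> T \<subseteq> {a..b} \<Longrightarrow>
        (\<Sum>K\<in>D. Sup K - Inf K) < d \<Longrightarrow> (\<Sum>K\<in>D. \<bar>g (Sup K) - g (Inf K)\<bar>) < e / 2"
    using absolutely_continuous_onD[OF ac half_gt_zero[OF \<open>e > 0\<close>]] by metis
  show "\<exists>\<delta>>0. \<forall>D T. D division_of T \<longrightarrow> T \<subseteq> {a..b} \<longrightarrow> (\<Sum>K\<in>D. Sup K - Inf K) < \<delta> \<longrightarrow>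
      (\<Sum>K\<in>D. \<bar>variation g a (Sup K) - variation g a (Inf K)\<bar>) < e"
  proof (intro exI[of _ d] conjI d(1) allI impI)
    fix D T assume D: "D division_of T" and T: "T \<subseteq> {a..b}" and len: "(\<Sum>K\<in>D. Sup K - Inf K) < d"
    \<comment> \<open>The errors over the \<open>card D\<close> intervals add up to at most
      \<open>e / 2\<close>; the \<open>+ 1\<close> covers the empty division.\<close>
    define \<eta> where "\<eta> = e / (2 * (real (card D) + 1))"
    have \<eta>: "\<eta> > 0" using \<open>e > 0\<close> by (simp add: \<eta>_def)
    have "\<exists>n t. mono t \<and> range t \<subseteq> K \<and>
        \<bar>variation g a (Sup K) - variation g a (Inf K)\<bar> \<le> var_sum g n t + \<eta>" if K: "K \<in> D" for K
    proof -
      obtain u v where uv: "K = {u..v}" "u \<le> v" using division_of_real_intervalE[OF D K] by blast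
      have "K \<subseteq> {a..b}" using division_ofD(2)[OF D K] T by auto
      then have ab: "a \<le> u" "v \<le> b" using uv by auto
      have "variation g u v - \<eta> < Sup (var_sums g u v)" using \<eta> by (simp add: variation_def)
      then obtain s where s: "s \<in> var_sums g u v" "variation g u v - \<eta> < s"
        using less_cSupD[of "var_sums g u v" "variation g u v - \<eta>"] var_sums_ne[OF uv(2)] by auto
      then obtain n t where t: "s = var_sum g n t" "mono t" "range t \<subseteq> {u..v}"
        unfolding var_sums_def by auto
      have "variation g a v \<le> variation g a u + variation g u v"
        using ab uv by (intro variation_split_le bdd) auto
      moreover have "\<bar>g v - g u\<bar> \<le> variation g a v - variation g a u"
        using ab uv by (intro abs_diff_le_variation_diff bdd) auto
      ultimately show ?thesis using t s uv by (intro exI[of _ n] exI[of _ t]) auto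
    qed
    then obtain n t where nt: "\<And>K. K \<in> D \<Longrightarrow> mono (t K)" "\<And>K. K \<in> D \<Longrightarrow> range (t K) \<subseteq> K"
       "\<And>K. K \<in> D \<Longrightarrow> \<bar>variation g a (Sup K) - variation g a (Inf K)\<bar> \<le> var_sum g (n K) (t K) + \<eta>"
      by metis
    obtain D' T' where D': "D' division_of T'" "T' \<subseteq> T"
      "(\<Sum>K\<in>D'. Sup K - Inf K) \<le> (\<Sum>K\<in>D. Sup K - Inf K)"
      "(\<Sum>K\<in>D'. \<bar>g (Sup K) - g (Inf K)\<bar>) = (\<Sum>K\<in>D. var_sum g (n K) (t K))"
      by (rule division_refine[OF D nt(1,2), where g = g and n = n])
    have "(\<Sum>K\<in>D. \<bar>variation g a (Sup K) - variation g a (Inf K)\<bar>) \<le> (\<Sum>K\<in>D. var_sum g (n K) (t K) + \<eta>)"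
      by (rule sum_mono) (rule nt(3))
    also have "\<dots> = (\<Sum>K\<in>D'. \<bar>g (Sup K) - g (Inf K)\<bar>) + real (card D) * \<eta>"
      by (simp add: sum.distrib D')
    also have "real (card D) * \<eta> \<le> e / 2"
      using \<open>e > 0\<close> by (simp add: \<eta>_def field_simps)
    also have "(\<Sum>K\<in>D'. \<bar>g (Sup K) - g (Inf K)\<bar>) < e / 2"
      using d(2)[of D' T'] D' T len by auto
    finally show "(\<Sum>K\<in>D. \<bar>variation g a (Sup K) - variation g a (Inf K)\<bar>) < e" by simp
  qed
qed

lemma absolutely_continuous_on_diff:
  assumes "absolutely_continuous_on S f" "absolutely_continuous_on S g"
  shows "absolutely_continuous_on S (\<lambda>x. f x - g x)"
  unfolding absolutely_continuous_on_def
proof (intro allI impI)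
  fix e :: real assume "e > 0"
  then have "e / 2 > 0" by simp
  obtain d1 where d1: "0 < d1" "\<And>D T. D division_of T \<Longrightarrow> T \<subseteq> S \<Longrightarrow>
        (\<Sum>K\<in>D. Sup K - Inf K) < d1 \<Longrightarrow> (\<Sum>K\<in>D. \<bar>f (Sup K) - f (Inf K)\<bar>) < e / 2"
    using absolutely_continuous_onD[OF assms(1) \<open>e / 2 > 0\<close>] by metis
  obtain d2 where d2: "0 < d2" "\<And>D T. D division_of T \<Longrightarrow> T \<subseteq> S \<Longrightarrow>
        (\<Sum>K\<in>D. Sup K - Inf K) < d2 \<Longrightarrow> (\<Sum>K\<in>D. \<bar>g (Sup K) - g (Inf K)\<bar>) < e / 2"
    using absolutely_continuous_onD[OF assms(2) \<open>e / 2 > 0\<close>] by metis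
  show "\<exists>\<delta>>0. \<forall>D T. D division_of T \<longrightarrow> T \<subseteq> S \<longrightarrow> (\<Sum>K\<in>D. Sup K - Inf K) < \<delta> \<longrightarrow>
      (\<Sum>K\<in>D. \<bar>f (Sup K) - g (Sup K) - (f (Inf K) - g (Inf K))\<bar>) < e"
  proof (intro exI[of _ "min d1 d2"] conjI allI impI)
    fix D T assume *: "D division_of T" "T \<subseteq> S" "(\<Sum>K\<in>D. Sup K - Inf K) < min d1 d2"
    have "(\<Sum>K\<in>D. \<bar>f (Sup K) - g (Sup K) - (f (Inf K) - g (Inf K))\<bar>) \<le>
       (\<Sum>K\<in>D. \<bar>f (Sup K) - f (Inf K)\<bar> + \<bar>g (Sup K) - g (Inf K)\<bar>)"
      by (rule sum_mono) auto
    also have "\<dots> < e" using d1(2)[of D T] d2(2)[of D T] * by (simp add: sum.distrib)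
    finally show "(\<Sum>K\<in>D. \<bar>f (Sup K) - g (Sup K) - (f (Inf K) - g (Inf K))\<bar>) < e" .
  qed (use d1 d2 in auto)
qed

lemma absolutely_continuous_on_imp_continuous_on:
  assumes ac: "absolutely_continuous_on {a..b} g"
  shows "continuous_on {a..b} g"
  unfolding continuous_on_iff
proof (intro ballI allI impI)
  fix x e assume x: "x \<in> {a..b}" and e: "0 < (e :: real)"
  obtain d where d: "0 < d" "\<And>D T. D division_of T \<Longrightarrow> T \<subseteq> {a..b} \<Longrightarrow>
        (\<Sum>K\<in>D. Sup K - Inf K) < d \<Longrightarrow> (\<Sum>K\<in>D. \<bar>g (Sup K) - g (Inf K)\<bar>) < e"
    using absolutely_continuous_onD[OF ac e] by metis
  have *: "\<bar>g v - g u\<bar> < e" if "u \<le> v" "v - u < d" "u \<in> {a..b}" "v \<in> {a..b}" for u v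
    using d(2)[of "{{u..v}}" "{u..v}"] division_of_self[of u v] that by auto
  have "\<bar>g x' - g x\<bar> < e" if "x' \<in> {a..b}" "\<bar>x' - x\<bar> < d" for x'
    using *[of x x'] *[of x' x] x that by (cases "x \<le> x'") (auto simp: abs_minus_commute)
  then show "\<exists>d>0. \<forall>x'\<in>{a..b}. dist x' x < d \<longrightarrow> dist (g x') (g x) < e"
    using d(1) by (auto simp: dist_real_def)
qed

text \<open>
  The density is the Radon--Nikodym derivative of the Stieltjes measure of \<open>w\<close>, which is absolutely
  continuous with respect to Lebesgue measure because \<open>w\<close> is.
\<close>

lemma mono_absolutely_continuous_density:
  fixes w :: "real \<Rightarrow> real"
  assumes mono: "mono_on {a..b} w" and ac: "absolutely_continuous_on {a..b} w" and ab: "a < b"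
  obtains h :: "real \<Rightarrow> real" where "\<And>x. 0 \<le> h x"
    "\<And>x y. a \<le> x \<Longrightarrow> x \<le> y \<Longrightarrow> y \<le> b \<Longrightarrow> (h has_integral w y - w x) {x..y}"
proof -
  \<comment> \<open>Constant continuation concentrates the Stieltjes measure on [a, b], so only the
    part of a null set inside [a, b] has to be covered.\<close>
  define F where "F x = w (max a (min b x))" for x
  let ?M = "interval_measure F"
  have Fw: "F x = w x" if "x \<in> {a..b}" for x
    using that by (simp add: F_def max_absorb2 min_absorb2)
  have monoF: "F x \<le> F y" if "x \<le> y" for x y
    unfolding F_def by (rule mono_onD[OF mono]) (use that ab in auto)
  have contF: "continuous_on UNIV F"
    unfolding F_def
    by (rule continuous_on_compose2[OF absolutely_continuous_on_imp_continuous_on[OF ac]])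
       (use ab in \<open>auto intro!: continuous_intros\<close>)
  have Icc: "emeasure ?M {x..y} = ennreal (F y - F x)" if "x \<le> y" for x y
    by (rule emeasure_interval_measure_Icc[OF that monoF contF])
  have out: "- {a..b} \<in> null_sets ?M"
  proof -
    have "{a - real n..a} \<union> {b..b + real n} \<in> null_sets ?M" for n
      using Icc[of "a - real n" a] Icc[of b "b + real n"] ab
      by (intro null_sets.Un null_setsI) (auto simp: F_def max_def min_def)
    then have null: "(\<Union>n. {a - real n..a} \<union> {b..b + real n}) \<in> null_sets ?M" by blast
    have "- {a..b} \<subseteq> (\<Union>n. {a - real n..a} \<union> {b..b + real n})"
    proof
      fix x assume "x \<in> - {a..b}"
      moreover obtain n where "max (a - x) (x - b) \<le> real n" using real_arch_simple by blast
      ultimately show "x \<in> (\<Union>n. {a - real n..a} \<union> {b..b + real n})" by (intro UN_I[of n]) auto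
    qed
    then show ?thesis by (intro null_sets_subset[OF null]) auto
  qed
  have "absolutely_continuous lborel ?M"
    unfolding absolutely_continuous_def
  proof
    fix N :: "real set" assume N: "N \<in> null_sets lborel"
    define S where "S = N \<inter> {a..b}"
    have S0: "S \<in> null_sets lborel"
      using N unfolding S_def by (auto intro: null_set_Int2)
    have "S \<in> null_sets lebesgue" using S0 by (simp add: null_sets_completionI)
    then have S: "S \<in> lmeasurable" "measure lebesgue S = 0"
      by (auto simp: fmeasurable_def null_sets_def measure_eq_0_null_sets)
    have "emeasure ?M S \<le> 0 + ennreal e" if e: "e > 0" for e
    proof -
      obtain d where d: "0 < d" "\<And>D T. D division_of T \<Longrightarrow> T \<subseteq> {a..b} \<Longrightarrow>
          (\<Sum>K\<in>D. Sup K - Inf K) < d \<Longrightarrow> (\<Sum>K\<in>D. \<bar>w (Sup K) - w (Inf K)\<bar>) < e"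
        using absolutely_continuous_onD[OF ac e] by metis
      have "S \<subseteq> cbox a b" by (auto simp: S_def)
      then obtain \<D> where \<D>: "countable \<D>" "\<And>K. K \<in> \<D> \<Longrightarrow> K \<subseteq> cbox a b \<and> K \<noteq> {} \<and> (\<exists>c d. K = cbox c d)"
        "pairwise (\<lambda>A B. interior A \<inter> interior B = {}) \<D>"
        "\<And>u v. cbox u v \<in> \<D> \<Longrightarrow> \<exists>n. \<forall>i \<in> Basis. v \<bullet> i - u \<bullet> i = (b \<bullet> i - a \<bullet> i)/2^n"
        "\<And>K. \<lbrakk>K \<in> \<D>; box a b \<noteq> {}\<rbrakk> \<Longrightarrow> interior K \<noteq> {}"
        "S \<subseteq> \<Union>\<D>" "\<Union>\<D> \<in> lmeasurable" "measure lebesgue (\<Union>\<D>) \<le> measure lebesgue S + d / 2"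
        by (rule measurable_outer_intervals_bounded[OF S(1) _ half_gt_zero[OF d(1)]]) (rule that, assumption+)
      \<comment> \<open>Absolute continuity speaks of finite families only. Each finite part of the
        cover is a division of total length below \<open>d\<close>; the bound \<open>e\<close> then
        passes to the countable union by continuity from below.\<close>
      have fin: "(\<Sum>K\<in>D. emeasure ?M K) \<le> ennreal e" if D: "finite D" "D \<subseteq> \<D>" for D
      proof -
        have div: "D division_of \<Union>D"
        proof (rule division_ofI)
          show "interior K \<inter> interior L = {}" if "K \<in> D" "L \<in> D" "K \<noteq> L" for K L
            using that D(2) \<D>(3) unfolding pairwise_def by blast
        qed (use D \<D>(2) in auto)
        have lm: "K \<in> sets lebesgue" if "K \<in> D" for K
          using \<D>(2) D(2) that by (metis fmeasurableD lmeasurable_cbox subsetD)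
        have "negligible (K \<inter> L)" if "K \<in> D" "L \<in> D" "K \<noteq> L" for K L
        proof -
          have "convex (K \<inter> L)" using \<D>(2) that D(2) by (metis convex_Int convex_box(1) subsetD)
          moreover have "interior (K \<inter> L) = {}" using \<D>(3) that D(2) by (auto simp: pairwise_def)
          ultimately show ?thesis using negligible_convex_interior by blast
        qed
        then have "(\<Sum>K\<in>D. measure lebesgue K) = measure lebesgue (\<Union>D)"
          using D \<D>(2) by (subst measure_negligible_finite_Union) (auto simp: pairwise_def)
        also have "\<dots> \<le> measure lebesgue (\<Union>\<D>)"
          using D \<D>(7) lm by (intro measure_mono_fmeasurable) (auto intro!: sets.finite_Union)
        also have "\<dots> < d" using \<D>(8) S(2) d(1) by linarith
        also have "(\<Sum>K\<in>D. measure lebesgue K) = (\<Sum>K\<in>D. Sup K - Inf K)"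
        proof (rule sum.cong[OF refl])
          fix K assume "K \<in> D"
          then obtain u v where "K = {u..v}" "u \<le> v" by (rule division_of_real_intervalE[OF div])
          then show "measure lebesgue K = Sup K - Inf K" by simp
        qed
        finally have "(\<Sum>K\<in>D. \<bar>w (Sup K) - w (Inf K)\<bar>) < e"
          using d(2)[OF div] D(2) \<D>(2) by auto
        moreover have "emeasure ?M K \<le> ennreal \<bar>w (Sup K) - w (Inf K)\<bar>" if "K \<in> D" for K
        proof -
          obtain u v where uv: "K = {u..v}" "u \<le> v" using division_of_real_intervalE[OF div \<open>K \<in> D\<close>] by blast
          moreover have "K \<subseteq> {a..b}" using \<D>(2) that D(2) by auto
          ultimately show ?thesis using Icc[OF uv(2)] by (auto simp: Fw intro!: ennreal_leI)
        qed
        then have "(\<Sum>K\<in>D. emeasure ?M K) \<le> (\<Sum>K\<in>D. ennreal \<bar>w (Sup K) - w (Inf K)\<bar>)"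
          by (rule sum_mono)
        ultimately show ?thesis
          by (simp add: sum_ennreal) (meson ennreal_leI less_imp_le order_trans)
      qed
      have sets: "K \<in> sets ?M" if "K \<in> \<D>" for K using \<D>(2)[OF that] by auto
      have "emeasure ?M (\<Union>\<D>) \<le> ennreal e"
      proof (cases "\<D> = {}")
        case False
        define f where "f = from_nat_into \<D>"
        have f: "range f = \<D>" unfolding f_def by (rule range_from_nat_into[OF False \<D>(1)])
        have "emeasure ?M (\<Union>\<D>) = emeasure ?M (\<Union>n. \<Union>(f ` {..<n}))"
          unfolding f[symmetric] by (rule arg_cong[where f = "emeasure ?M"]) auto
        also have "\<dots> = (SUP n. emeasure ?M (\<Union>(f ` {..<n})))"
        proof (rule SUP_emeasure_incseq[symmetric])
          show "incseq (\<lambda>n. \<Union>(f ` {..<n}))" by (intro monoI UN_mono) auto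
        qed (use sets f in auto)
        also have "\<dots> \<le> ennreal e"
        proof (rule SUP_least)
          fix n
          have "emeasure ?M (\<Union>(f ` {..<n})) = emeasure ?M (\<Union>K\<in>f ` {..<n}. K)" by simp
          also have "\<dots> \<le> (\<Sum>K\<in>f ` {..<n}. emeasure ?M K)"
            using sets f by (intro emeasure_subadditive_finite) auto
          also have "\<dots> \<le> ennreal e" using f by (intro fin) auto
          finally show "emeasure ?M (\<Union>(f ` {..<n})) \<le> ennreal e" .
        qed
        finally show ?thesis .
      qed simp
      moreover have "emeasure ?M S \<le> emeasure ?M (\<Union>\<D>)"
        using sets \<D>(1,6) by (intro emeasure_mono sets.countable_Union) auto
      ultimately show ?thesis by simp
    qed
    then have "emeasure ?M S \<le> 0" by (rule ennreal_le_epsilon)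
    then have "S \<in> null_sets ?M" using S0 by (intro null_setsI) auto
    then have "S \<union> - {a..b} \<in> null_sets ?M" using out by blast
    then show "N \<in> null_sets ?M"
      by (rule null_sets_subset) (use N in \<open>auto simp: S_def\<close>)
  qed
  then obtain f where f: "f \<in> borel_measurable lborel" "density lborel f = ?M"
    using sigma_finite_measure.Radon_Nikodym[OF lborel.sigma_finite_measure_axioms, of ?M] by auto
  have [measurable]: "f \<in> borel_measurable borel" using f by simp
  have int: "(\<integral>\<^sup>+t. f t * indicator {x..y} t \<partial>lborel) = ennreal (F y - F x)" if "x \<le> y" for x y
    using Icc[OF that] unfolding f(2)[symmetric] by (subst (asm) emeasure_density) auto
  have "AE t in lborel. f t * indicator {a..b} t \<noteq> \<infinity>"
    by (rule nn_integral_PInf_AE) (use int[of a b] ab in auto)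
  then have fin: "AE t in lborel. t \<in> {a..b} \<longrightarrow> ennreal (enn2real (f t)) = f t"
    by eventually_elim (auto simp: less_top)
  show ?thesis
  proof (rule that[of "\<lambda>t. enn2real (f t)"])
    fix x y assume xy: "a \<le> x" "x \<le> y" "y \<le> b"
    have "(\<integral>\<^sup>+t. ennreal (if t \<in> {x..y} then enn2real (f t) else 0) \<partial>lborel) = (\<integral>\<^sup>+t. f t * indicator {x..y} t \<partial>lborel)"
      using fin by (intro nn_integral_cong_AE, eventually_elim) (use xy in \<open>auto simp: indicator_def\<close>)
    also have "\<dots> = ennreal (w y - w x)" using int[OF xy(2)] xy by (simp add: Fw)
    finally have "((\<lambda>t. if t \<in> {x..y} then enn2real (f t) else 0) has_integral (w y - w x)) UNIV"
      using xy mono_onD[OF mono, of x y] by (intro nn_integral_has_integral) auto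
    then show "((\<lambda>t. enn2real (f t)) has_integral w y - w x) {x..y}"
      by (simp only: has_integral_restrict_UNIV)
  qed simp
qed

section \<open>Lebesgue differentiation and the fundamental theorem of calculus\<close>

lemma AE_integral_right_derivative:
  fixes f :: "real \<Rightarrow> real"
  assumes "\<And>a b. f integrable_on {a..b}"
  shows "AE x in lebesgue. ((\<lambda>h. integral {x..x + h} f / h) \<longlongrightarrow> f x) (at_right 0)"
proof -
  obtain N where N: "negligible N" "\<And>x e. \<lbrakk>x \<notin> N; 0 < e\<rbrakk> \<Longrightarrow>
      \<exists>d>0. \<forall>h. 0 < h \<and> h < d \<longrightarrow> norm (integral (cbox x (x + h *\<^sub>R One)) f /\<^sub>R h ^ DIM(real) - f x) < e"
    by (rule integrable_ccontinuous_explicit[of f]) (use assms in auto)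
  have "((\<lambda>h. integral {x..x + h} f / h) \<longlongrightarrow> f x) (at_right 0)" if "x \<notin> N" for x
    unfolding tendsto_iff eventually_at_right_field dist_real_def
    using N(2)[OF that] by (fastforce simp: divide_inverse mult.commute)
  then show ?thesis
    using N(1) by (intro AE_I'[of N]) (auto simp: negligible_iff_null_sets)
qed

text \<open>The reflection at 0 exchanges left and right averages and maps null sets to null
  sets.\<close>

lemma AE_integral_left_derivative:
  fixes f :: "real \<Rightarrow> real"
  assumes f: "\<And>a b. f integrable_on {a..b}"
  shows "AE x in lebesgue. ((\<lambda>h. integral {x - h..x} f / h) \<longlongrightarrow> f x) (at_right 0)"
proof -
  have "(\<lambda>x. f (- x)) integrable_on {a..b}" for a b
    using f[of "- b" "- a"] Henstock_Kurzweil_Integration.integrable_reflect_real[where f = f and a = "- b" and b = "- a"] by simp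
  then have "AE x in lebesgue. ((\<lambda>h. integral {x..x + h} (\<lambda>x. f (- x)) / h) \<longlongrightarrow> f (- x)) (at_right 0)"
    by (rule AE_integral_right_derivative)
  then obtain N where N: "negligible N"
    "\<And>x. x \<notin> N \<Longrightarrow> ((\<lambda>h. integral {x..x + h} (\<lambda>x. f (- x)) / h) \<longlongrightarrow> f (- x)) (at_right 0)"
    unfolding eventually_ae_filter_negligible by auto
  have "negligible (uminus ` N)"
    by (rule negligible_differentiable_image_negligible[OF _ N(1)]) (auto intro!: derivative_intros simp: differentiable_on_def)
  moreover have "((\<lambda>h. integral {x - h..x} f / h) \<longlongrightarrow> f x) (at_right 0)" if "x \<notin> uminus ` N" for x
  proof -
    have "- x \<notin> N" using that by force
    moreover have "integral {- x..- x + h} (\<lambda>x. f (- x)) = integral {x - h..x} f" for h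
      using Henstock_Kurzweil_Integration.integral_reflect_real[where f = f and b = x and a = "x - h"] by simp
    ultimately show ?thesis using N(2)[of "- x"] by simp
  qed
  ultimately show ?thesis
    by (intro AE_I'[of "uminus ` N"]) (auto simp: negligible_iff_null_sets)
qed

lemma DERIV_from_sides:
  fixes g :: "real \<Rightarrow> real"
  assumes "((\<lambda>h. (g (x + h) - g x) / h) \<longlongrightarrow> D) (at_right 0)"
    and "((\<lambda>h. (g x - g (x - h)) / h) \<longlongrightarrow> D) (at_right 0)"
  shows "(g has_real_derivative D) (at x)"
proof -
  have "((\<lambda>h. (g (x + h) - g x) / h) \<longlongrightarrow> D) (at_left 0)"
    unfolding filterlim_at_left_to_right
    using assms(2) by (simp add: minus_divide_right[symmetric] minus_divide_left)
  with assms(1) show ?thesis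
    unfolding DERIV_def filterlim_at_split by simp
qed

text \<open>Jordan decomposition: \<open>variation g a\<close> and its difference with
  \<open>g\<close> are both monotone and absolutely continuous, so each has a density.\<close>

lemma absolutely_continuous_on_density:
  fixes g :: "real \<Rightarrow> real"
  assumes ac: "absolutely_continuous_on {a..b} g" and ab: "a < b"
  obtains k where "k absolutely_integrable_on {a..b}"
    "\<And>x y. a \<le> x \<Longrightarrow> x \<le> y \<Longrightarrow> y \<le> b \<Longrightarrow> (k has_integral g y - g x) {x..y}"
proof -
  let ?V = "variation g a"
  have bdd: "bdd_above (var_sums g a y)" if "y \<le> b" for y
    by (rule absolutely_continuous_on_bdd_var_sums, rule absolutely_continuous_on_subset[OF ac]) (use that in auto)
  have V: "\<bar>g y - g x\<bar> \<le> ?V y - ?V x" if "a \<le> x" "x \<le> y" "y \<le> b" for x y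
    using that by (intro abs_diff_le_variation_diff bdd) auto
  have acV: "absolutely_continuous_on {a..b} ?V"
    by (rule absolutely_continuous_on_variation[OF ac])
  have "mono_on {a..b} ?V"
    using V by (intro mono_onI) (smt (verit) atLeastAtMost_iff)
  then obtain h1 where h1: "\<And>x. 0 \<le> h1 x"
    "\<And>x y. a \<le> x \<Longrightarrow> x \<le> y \<Longrightarrow> y \<le> b \<Longrightarrow> (h1 has_integral ?V y - ?V x) {x..y}"
    by (rule mono_absolutely_continuous_density[OF _ acV ab]) (rule that, assumption+)
  have "mono_on {a..b} (\<lambda>x. ?V x - g x)"
    using V by (intro mono_onI) (smt (verit) atLeastAtMost_iff)
  then obtain h2 where h2: "\<And>x. 0 \<le> h2 x"
    "\<And>x y. a \<le> x \<Longrightarrow> x \<le> y \<Longrightarrow> y \<le> b \<Longrightarrow> (h2 has_integral (?V y - g y) - (?V x - g x)) {x..y}"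
    by (rule mono_absolutely_continuous_density[OF _ absolutely_continuous_on_diff[OF acV ac] ab]) (rule that, assumption+)
  show ?thesis
  proof (rule that[of "\<lambda>x. h1 x - h2 x"])
    have "h1 absolutely_integrable_on {a..b}" "h2 absolutely_integrable_on {a..b}"
      using h1(1) h2(1) has_integral_integrable[OF h1(2)[of a b]] has_integral_integrable[OF h2(2)[of a b]] ab
      by (auto intro!: nonnegative_absolutely_integrable_1)
    then show "(\<lambda>x. h1 x - h2 x) absolutely_integrable_on {a..b}" by (rule set_integral_diff)
    fix x y assume "a \<le> x" "x \<le> y" "y \<le> b"
    then show "((\<lambda>x. h1 x - h2 x) has_integral g y - g x) {x..y}"
      using has_integral_diff[OF h1(2) h2(2), of x y] by (simp add: algebra_simps)
  qed
qed

lemma AE_real_intervals: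
  assumes "\<And>n :: nat. AE x in lebesgue. x \<in> {- real n<..<real n} \<longrightarrow> P x"
  shows "AE x in lebesgue. P x"
proof -
  have "AE x in lebesgue. \<forall>n :: nat. x \<in> {- real n<..<real n} \<longrightarrow> P x"
    using assms unfolding AE_all_countable by blast
  then show ?thesis
  proof eventually_elim
    fix x :: real assume *: "\<forall>n :: nat. x \<in> {- real n<..<real n} \<longrightarrow> P x"
    obtain n where "\<bar>x\<bar> < real n" using reals_Archimedean2 by blast
    then have "x \<in> {- real n<..<real n}" by auto
    then show "P x" using * by blast
  qed
qed

text \<open>The density found on an interval depends on that interval. Differentiating its integral
  identifies it almost everywhere with \<open>deriv g\<close>, which is one function for all
  intervals.\<close>

lemma locally_absolutely_continuous_AE_differentiable:
  assumes "locally_absolutely_continuous g"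
  shows "AE x in lebesgue. (g has_real_derivative deriv g x) (at x)"
    and "deriv g absolutely_integrable_on {a..b}"
    and "a \<le> b \<Longrightarrow> (deriv g has_integral g b - g a) {a..b}"
proof -
  have main: "\<exists>k. k absolutely_integrable_on {a..b} \<and>
     (\<forall>x y. a \<le> x \<longrightarrow> x \<le> y \<longrightarrow> y \<le> b \<longrightarrow> (k has_integral g y - g x) {x..y}) \<and>
     (AE x in lebesgue. x \<in> {a<..<b} \<longrightarrow> (g has_real_derivative k x) (at x))" if ab: "a < b" for a b
  proof -
    have "absolutely_continuous_on {a..b} g"
      using assms by (simp add: locally_absolutely_continuous_def)
    then obtain k where k: "k absolutely_integrable_on {a..b}"
      "\<And>x y. a \<le> x \<Longrightarrow> x \<le> y \<Longrightarrow> y \<le> b \<Longrightarrow> (k has_integral g y - g x) {x..y}"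
      by (rule absolutely_continuous_on_density[OF _ ab]) (rule that, assumption+)
    \<comment> \<open>The differentiation lemmas ask for integrability on every interval; extension
      by zero provides it and leaves the integrals inside [a, b] unchanged.\<close>
    define k' where "k' x = (if x \<in> {a..b} then k x else 0)" for x
    have "k integrable_on {a..b}" using k(1) by (rule set_lebesgue_integral_eq_integral(1))
    then have "k' integrable_on UNIV" unfolding k'_def by (simp only: integrable_restrict_UNIV)
    then have int: "k' integrable_on {u..v}" for u v
      by (rule integrable_on_subinterval) simp
    have k': "integral {x..y} k' = g y - g x" if "a \<le> x" "x \<le> y" "y \<le> b" for x y
      using k(2)[OF that] that integral_cong[of "{x..y}" k' k] by (auto simp: k'_def integral_unique)
    have "AE x in lebesgue. x \<in> {a<..<b} \<longrightarrow> (g has_real_derivative k x) (at x)"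
      using AE_integral_right_derivative[OF int] AE_integral_left_derivative[OF int]
    proof eventually_elim
      case (elim x)
      show ?case
      proof
        assume x: "x \<in> {a<..<b}"
        then have kx: "k' x = k x" by (simp add: k'_def)
        have "\<forall>\<^sub>F h in at_right 0. integral {x..x + h} k' / h = (g (x + h) - g x) / h"
          unfolding eventually_at_right_field
          by (rule exI[of _ "b - x"]) (use x k' in auto)
        then have r: "((\<lambda>h. (g (x + h) - g x) / h) \<longlongrightarrow> k x) (at_right 0)"
          using elim(1) unfolding kx by (rule Lim_transform_eventually[rotated])
        have "\<forall>\<^sub>F h in at_right 0. integral {x - h..x} k' / h = (g x - g (x - h)) / h"
          unfolding eventually_at_right_field
          by (rule exI[of _ "x - a"]) (use x k' in auto)
        then have "((\<lambda>h. (g x - g (x - h)) / h) \<longlongrightarrow> k x) (at_right 0)"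
          using elim(2) unfolding kx by (rule Lim_transform_eventually[rotated])
        with r show "(g has_real_derivative k x) (at x)" by (rule DERIV_from_sides)
      qed
    qed
    with k show ?thesis by blast
  qed
  show "AE x in lebesgue. (g has_real_derivative deriv g x) (at x)"
  proof (rule AE_real_intervals)
    fix n :: nat
    show "AE x in lebesgue. x \<in> {- real n<..<real n} \<longrightarrow> (g has_real_derivative deriv g x) (at x)"
    proof (cases "n = 0")
      case False
      then obtain k where "AE x in lebesgue. x \<in> {- real n<..<real n} \<longrightarrow> (g has_real_derivative k x) (at x)"
        using main[of "- real n" "real n"] by auto
      then show ?thesis by eventually_elim (auto simp: DERIV_imp_deriv)
    qed simp
  qed
  have fin: "deriv g absolutely_integrable_on {a..b} \<and> (deriv g has_integral g b - g a) {a..b}" if ab: "a < b"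
  proof -
    obtain k where k: "k absolutely_integrable_on {a..b}" "(k has_integral g b - g a) {a..b}"
      "AE x in lebesgue. x \<in> {a<..<b} \<longrightarrow> (g has_real_derivative k x) (at x)"
      using main[OF ab] ab by auto
    obtain N where N: "negligible N" "\<And>x. x \<notin> N \<Longrightarrow> x \<in> {a<..<b} \<Longrightarrow> (g has_real_derivative k x) (at x)"
      using k(3) unfolding eventually_ae_filter_negligible by blast
    have N': "negligible (N \<union> {a, b})" using N(1) by simp
    have eq: "deriv g x = k x" if "x \<in> {a..b} - (N \<union> {a, b})" for x
      using N(2)[of x] that by (intro DERIV_imp_deriv) auto
    show ?thesis
      using absolutely_integrable_spike[OF k(1) N' eq] has_integral_spike[OF N' eq k(2)] by simp
  qed
  show "deriv g absolutely_integrable_on {a..b}"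
  proof (cases "a < b")
    case False
    then have "negligible {a..b}" by (cases "a = b") auto
    then show ?thesis by (rule absolutely_integrable_negligible)
  qed (use fin in blast)
  show "(deriv g has_integral g b - g a) {a..b}" if "a \<le> b"
    using that fin by (cases "a = b") auto
qed

section \<open>The Hardy--Littlewood maximal inequality\<close>

text \<open>
  The function \<open>s\<close> is any measurable minorant of twice the maximal function of \<open>h\<close>; the maximal function
  itself need not be shown measurable.
\<close>

lemma weak_type_maximal:
  fixes h s :: "real \<Rightarrow> ennreal"
  assumes [measurable]: "h \<in> borel_measurable borel" "s \<in> borel_measurable borel"
    and max: "\<And>x \<alpha>. 0 < \<alpha> \<Longrightarrow> ennreal \<alpha> < s x \<Longrightarrow>
      \<exists>r>0. ennreal (\<alpha> * r) < (\<integral>\<^sup>+y. h y * indicator {x - r..x + r} y \<partial>lborel)"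
    and \<alpha>: "0 < \<alpha>"
  shows "emeasure lborel {x. ennreal \<alpha> < s x} \<le>
     ennreal (20 / \<alpha>) * (\<integral>\<^sup>+y. h y * indicator {y. ennreal (\<alpha> / 4) < h y} y \<partial>lborel)"
proof -
  \<comment> \<open>On an interval of length 2r the values \<open>h \<le> \<alpha> / 4\<close>
    account for at most \<open>\<alpha> * r / 2\<close>, half of the mass that \<open>max\<close>
    guarantees; the other half must come from \<open>k\<close>. Having only \<open>k\<close> in the
    bound is what makes the later integration over levels converge.\<close>
  define k where "k y = h y * indicator {y. ennreal (\<alpha> / 4) < h y} y" for y
  have [measurable]: "k \<in> borel_measurable borel" unfolding k_def by measurable
  define A where "A = {x. ennreal \<alpha> < s x}"
  have [measurable]: "A \<in> sets borel" unfolding A_def by measurable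
  have [measurable]: "cball c q \<in> sets borel" for c q :: real by (rule borel_closed) simp
  have km: "(\<lambda>x. k x * indicator (cball c q) x) \<in> borel_measurable borel" for c q by measurable
  let ?I = "\<integral>\<^sup>+y. k y \<partial>lborel"
  have "emeasure lborel A \<le> ennreal (20 / \<alpha>) * ?I"
  proof (cases "?I = top")
    case True
    then show ?thesis using \<alpha> by (simp add: ennreal_mult_top)
  next
    case False
    then obtain i where i: "?I = ennreal i" "0 \<le> i" by (cases ?I) auto
    have "\<exists>r>0. ennreal (\<alpha> * r / 2) \<le> (\<integral>\<^sup>+y. k y * indicator (cball x r) y \<partial>lborel)" if "x \<in> A" for x
    proof -
      obtain r where r: "r > 0" "ennreal (\<alpha> * r) < (\<integral>\<^sup>+y. h y * indicator {x - r..x + r} y \<partial>lborel)"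
        using max[OF \<alpha>, of x] \<open>x \<in> A\<close> by (auto simp: A_def)
      have "(\<integral>\<^sup>+y. h y * indicator {x - r..x + r} y \<partial>lborel)
         \<le> (\<integral>\<^sup>+y. ennreal (\<alpha> / 4) * indicator {x - r..x + r} y + k y * indicator {x - r..x + r} y \<partial>lborel)"
        by (rule nn_integral_mono) (auto simp: k_def indicator_def not_less)
      also have "\<dots> = ennreal (\<alpha> / 4) * ennreal (2 * r) + (\<integral>\<^sup>+y. k y * indicator {x - r..x + r} y \<partial>lborel)"
        using r(1) by (subst nn_integral_add) (auto simp: nn_integral_cmult_indicator)
      also have "ennreal (\<alpha> / 4) * ennreal (2 * r) = ennreal (\<alpha> * r / 2)"
        using r(1) \<alpha> by (simp add: ennreal_mult[symmetric])
      finally have le: "ennreal (\<alpha> * r) < ennreal (\<alpha> * r / 2) + (\<integral>\<^sup>+y. k y * indicator {x - r..x + r} y \<partial>lborel)"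
        using r(2) by order
      have "(\<integral>\<^sup>+y. k y * indicator {x - r..x + r} y \<partial>lborel) \<le> ?I"
        by (rule nn_integral_mono) (auto simp: indicator_def)
      then obtain j where j: "(\<integral>\<^sup>+y. k y * indicator {x - r..x + r} y \<partial>lborel) = ennreal j" "0 \<le> j"
        using i by (cases "\<integral>\<^sup>+y. k y * indicator {x - r..x + r} y \<partial>lborel") (auto simp: top_unique)
      have "ennreal (\<alpha> * r) < ennreal (\<alpha> * r / 2 + j)"
        using le j r(1) \<alpha> by (simp add: ennreal_plus)
      then have "\<alpha> * r < \<alpha> * r / 2 + j"
        by (metis ennreal_leI not_le)
      then have "ennreal (\<alpha> * r / 2) \<le> ennreal j" by (intro ennreal_leI) simp
      then show ?thesis using r(1) j by (intro exI[of _ r]) (simp add: cball_eq_atLeastAtMost)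
    qed
    then obtain r where r: "\<And>x. x \<in> A \<Longrightarrow> r x > 0"
      "\<And>x. x \<in> A \<Longrightarrow> ennreal (\<alpha> * r x / 2) \<le> (\<integral>\<^sup>+y. k y * indicator (cball x (r x)) y \<partial>lborel)"
      by metis
    \<comment> \<open>Finite total mass of \<open>k\<close> bounds the radii, as the Vitali covering
      lemma requires.\<close>
    have bound: "0 < r x \<and> r x \<le> 2 * i / \<alpha>" if "x \<in> A" for x
    proof -
      have "ennreal (\<alpha> * r x / 2) \<le> ?I"
        by (rule order_trans[OF r(2)[OF that]]) (auto intro!: nn_integral_mono simp: indicator_def)
      then have "\<alpha> * r x / 2 \<le> i" using i by simp
      then show ?thesis using r(1)[OF that] \<alpha> by (simp add: field_simps)
    qed
    have cov: "A \<subseteq> (\<Union>x\<in>A. cball x (r x))" using r(1) by (force simp: less_imp_le)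
    obtain C where C: "countable C" "C \<subseteq> A"
       "pairwise (\<lambda>i j. disjnt (cball i (r i)) (cball j (r j))) C"
       "A \<subseteq> (\<Union>i\<in>C. cball i (5 * r i))"
      by (rule Vitali_covering_lemma_cballs[OF cov, of "2 * i / \<alpha>"], erule bound, rule that)
    \<comment> \<open>The selected balls are disjoint, so adding up the masses of \<open>k\<close>
      over them counts no point twice.\<close>
    have one: "(\<integral>\<^sup>+c. indicator (cball c (r c)) y \<partial>count_space C) \<le> 1" for y
    proof -
      let ?S = "{c \<in> C. y \<in> cball c (r c)}"
      have "a = b" if "a \<in> ?S" "b \<in> ?S" for a b
        using that C(3) by (auto simp: pairwise_def disjnt_iff)
      then obtain a where a: "?S \<subseteq> {a}" by blast
      have S: "finite ?S" "card ?S \<le> 1"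
        using finite_subset[OF a] card_mono[OF _ a] by auto
      have "(\<integral>\<^sup>+c. indicator (cball c (r c)) y \<partial>count_space C) = (\<integral>\<^sup>+c. indicator ?S c \<partial>count_space C)"
        by (rule nn_integral_cong) (auto simp: indicator_def)
      also have "\<dots> = emeasure (count_space C) ?S" by simp
      also have "\<dots> \<le> 1" using S by (subst emeasure_count_space) (auto simp del: mem_cball simp flip: ennreal_1)
      finally show ?thesis .
    qed
    have "emeasure lborel A = (\<integral>\<^sup>+x. indicator A x \<partial>lborel)" by simp
    also have "\<dots> \<le> (\<integral>\<^sup>+x. \<integral>\<^sup>+c. indicator (cball c (5 * r c)) x \<partial>count_space C \<partial>lborel)"
    proof (rule nn_integral_mono)
      fix x
      show "indicator A x \<le> (\<integral>\<^sup>+c. indicator (cball c (5 * r c)) x \<partial>count_space C :: ennreal)"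
      proof (cases "x \<in> A")
        case True
        then obtain c where c: "c \<in> C" "x \<in> cball c (5 * r c)" using C(4) by blast
        have "(1 :: ennreal) = (\<integral>\<^sup>+d. indicator {c} d \<partial>count_space C)"
          using c by (simp add: emeasure_count_space)
        also have "\<dots> \<le> (\<integral>\<^sup>+c. indicator (cball c (5 * r c)) x \<partial>count_space C)"
          by (rule nn_integral_mono) (use c in \<open>auto simp: indicator_def\<close>)
        finally show ?thesis using True by simp
      qed simp
    qed
    also have "\<dots> = (\<integral>\<^sup>+c. \<integral>\<^sup>+x. indicator (cball c (5 * r c)) x \<partial>lborel \<partial>count_space C)"
      by (rule nn_integral_count_space_nn_integral[OF C(1)]) (auto intro!: borel_measurable_indicator)
    also have "\<dots> \<le> (\<integral>\<^sup>+c. \<integral>\<^sup>+x. ennreal (20 / \<alpha>) * (k x * indicator (cball c (r c)) x) \<partial>lborel \<partial>count_space C)"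
    proof (rule nn_integral_mono)
      fix c assume "c \<in> space (count_space C)"
      then have c: "c \<in> A" using C(2) by auto
      have "(\<integral>\<^sup>+x. indicator (cball c (5 * r c)) x \<partial>lborel) = ennreal (10 * r c)"
        using r(1)[OF c] by (simp add: cball_eq_atLeastAtMost)
      \<comment> \<open>The enlarged ball has length 10r and the ball itself carries mass at least
        \<open>\<alpha> * r / 2\<close>; the quotient is the constant
        \<open>20 / \<alpha>\<close>.\<close>
      also have "\<dots> = ennreal (20 / \<alpha>) * ennreal (\<alpha> * r c / 2)"
        using r(1)[OF c] \<alpha> by (simp add: ennreal_mult[symmetric])
      also have "\<dots> \<le> ennreal (20 / \<alpha>) * (\<integral>\<^sup>+x. k x * indicator (cball c (r c)) x \<partial>lborel)"
        by (rule mult_left_mono[OF r(2)[OF c]]) simp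
      also have "\<dots> = (\<integral>\<^sup>+x. ennreal (20 / \<alpha>) * (k x * indicator (cball c (r c)) x) \<partial>lborel)"
        by (rule nn_integral_cmult[symmetric]) (simp add: km)
      finally show "(\<integral>\<^sup>+x. indicator (cball c (5 * r c)) x \<partial>lborel)
          \<le> (\<integral>\<^sup>+x. ennreal (20 / \<alpha>) * (k x * indicator (cball c (r c)) x) \<partial>lborel)" .
    qed
    also have "\<dots> = (\<integral>\<^sup>+x. \<integral>\<^sup>+c. ennreal (20 / \<alpha>) * (k x * indicator (cball c (r c)) x) \<partial>count_space C \<partial>lborel)"
      by (rule nn_integral_count_space_nn_integral[OF C(1), symmetric]) (simp add: borel_measurable_times_ennreal km)
    also have "\<dots> = (\<integral>\<^sup>+x. ennreal (20 / \<alpha>) * (k x * (\<integral>\<^sup>+c. indicator (cball c (r c)) x \<partial>count_space C)) \<partial>lborel)"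
      by (simp add: nn_integral_cmult)
    also have "\<dots> \<le> (\<integral>\<^sup>+x. ennreal (20 / \<alpha>) * (k x * 1) \<partial>lborel)"
      by (intro nn_integral_mono mult_left_mono one) auto
    also have "\<dots> = ennreal (20 / \<alpha>) * ?I" by (simp add: nn_integral_cmult)
    finally show ?thesis .
  qed
  then show ?thesis unfolding A_def k_def .
qed

section \<open>From weak type to strong type by integration over levels\<close>

lemma nn_integral_powr_Ioo:
  fixes a c :: real
  assumes "a > -1" "c \<ge> 0"
  shows "(\<integral>\<^sup>+x. ennreal (x powr a) * indicator {0<..<c} x \<partial>lborel) = ennreal (c powr (a + 1) / (a + 1))"
proof -
  have "AE x in lborel. x \<noteq> 0 \<and> x \<noteq> c"
    using AE_lborel_singleton[of "0::real"] AE_lborel_singleton[of c] by eventually_elim auto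
  then have "(\<integral>\<^sup>+x. ennreal (x powr a) * indicator {0<..<c} x \<partial>lborel) = (\<integral>\<^sup>+x. ennreal (x powr a) * indicator {0..c} x \<partial>lborel)"
    by (intro nn_integral_cong_AE, eventually_elim) (auto simp: indicator_def)
  also have "\<dots> = ennreal (c powr (a + 1) / (a + 1))"
    by (rule nn_integral_has_integral_lebesgue'[OF _ has_integral_powr_from_0[OF assms]]) auto
  finally show ?thesis .
qed

lemma ennpow_ennreal: "0 \<le> u \<Longrightarrow> ennpow (ennreal u) p = ennreal (u powr p)"
  by (simp add: ennpow_def)

lemma ennpow_top: "ennpow top p = top"
  by (simp add: ennpow_def)

lemma ennpow_le_layers:
  fixes c :: ennreal
  assumes p: "1 < p"
  shows "ennpow c p \<le> (\<integral>\<^sup>+t. (if 0 < t \<and> ennreal t < c then ennreal (p * t powr (p - 1)) else 0) \<partial>lborel)"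
    (is "_ \<le> ?R c")
proof -
  have real: "?R (ennreal u) = ennreal (u powr p)" if "0 \<le> u" for u
  proof -
    have "?R (ennreal u) = (\<integral>\<^sup>+t. ennreal p * (ennreal (t powr (p - 1)) * indicator {0<..<u} t) \<partial>lborel)"
      using p that by (intro nn_integral_cong) (auto simp: indicator_def ennreal_mult[symmetric] ennreal_less_iff)
    also have "\<dots> = ennreal (u powr p)"
      using p that by (simp add: nn_integral_cmult nn_integral_powr_Ioo ennreal_mult[symmetric])
    finally show ?thesis .
  qed
  show ?thesis
  proof (cases c)
    case (real u)
    then show ?thesis using \<open>\<And>u. 0 \<le> u \<Longrightarrow> ?R (ennreal u) = ennreal (u powr p)\<close> by (simp add: ennpow_ennreal)
  next
    case top
    \<comment> \<open>The right side must be shown to be infinite as well: by comparison with the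
      finite case it is at least \<open>n powr p\<close>, hence at least \<open>n\<close>, for every
      natural \<open>n > 0\<close>.\<close>
    have "of_nat n \<le> ?R top" for n
    proof (cases "n = 0")
      case False
      have "of_nat n = ennreal (real n powr 1)" by (simp add: ennreal_of_nat_eq_real_of_nat)
      also have "\<dots> \<le> ennreal (real n powr p)"
        using False p by (intro ennreal_leI powr_mono) auto
      also have "\<dots> = ?R (ennreal (real n))" using real[of "real n"] by simp
      also have "\<dots> \<le> ?R top" by (intro nn_integral_mono) auto
      finally show ?thesis .
    qed simp
    then have "?R top = top"
      by (metis ennreal_Ex_less_of_nat less_top not_le)
    then show ?thesis using top by simp
  qed
qed

text \<open>This is the inner integral after Fubini. At height \<open>u\<close> only the levels
  \<open>t < 4 * u\<close> contribute, with integrand \<open>20 * p * u * t powr (p - 2)\<close>,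
  which is integrable at 0 because p > 1.\<close>

lemma layers_le_ennpow:
  fixes c :: ennreal
  assumes p: "1 < p"
  shows "(\<integral>\<^sup>+t. (if 0 < t then ennreal (p * t powr (p - 1)) * (ennreal (20 / t) * (c * (if ennreal (t / 4) < c then 1 else 0))) else 0) \<partial>lborel)
    \<le> ennreal (20 * p * 4 powr (p - 1) / (p - 1)) * ennpow c p" (is "?L c \<le> _")
proof (cases c)
  case (real u)
  have "?L c = (\<integral>\<^sup>+t. ennreal (20 * p * u) * (ennreal (t powr (p - 2)) * indicator {0<..<4 * u} t) \<partial>lborel)"
  proof (rule nn_integral_cong)
    fix t :: real
    have "t powr (p - 1) = t * t powr (p - 2)" if "t > 0"
      using that by (simp add: powr_diff power2_eq_square powr_numeral[symmetric] flip: powr_realpow)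
    then show "(if 0 < t then ennreal (p * t powr (p - 1)) * (ennreal (20 / t) * (c * (if ennreal (t / 4) < c then 1 else 0))) else 0)
       = ennreal (20 * p * u) * (ennreal (t powr (p - 2)) * indicator {0<..<4 * u} t)"
      using p real by (auto simp: indicator_def ennreal_mult[symmetric] ennreal_less_iff field_simps)
  qed
  also have "\<dots> = ennreal (20 * p * u) * ennreal ((4 * u) powr (p - 1) / (p - 1))"
    using p real(1) nn_integral_powr_Ioo[of "p - 2" "4 * u"] by (subst nn_integral_cmult) auto
  also have "\<dots> = ennreal (20 * p * 4 powr (p - 1) / (p - 1)) * ennpow c p"
  proof -
    have "u * u powr (p - 1) = u powr p"
      using real(1) p by (cases "u = 0") (auto simp: powr_diff)
    then show ?thesis
      using real p by (simp add: ennpow_ennreal ennreal_mult[symmetric] powr_mult)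
  qed
  finally show ?thesis by simp
next
  case top
  then show ?thesis using p by (simp add: ennpow_top ennreal_mult_top)
qed

text \<open>The p-th power is written as an integral over levels, each level set is bounded by the
  weak type estimate, and Fubini leaves for every \<open>y\<close> an integral over the levels below
  \<open>4 * h y\<close>.\<close>

lemma strong_type_maximal:
  fixes h s :: "real \<Rightarrow> ennreal"
  assumes p: "1 < p" and [measurable]: "h \<in> borel_measurable borel" "s \<in> borel_measurable borel"
    and max: "\<And>x \<alpha>. 0 < \<alpha> \<Longrightarrow> ennreal \<alpha> < s x \<Longrightarrow>
      \<exists>r>0. ennreal (\<alpha> * r) < (\<integral>\<^sup>+y. h y * indicator {x - r..x + r} y \<partial>lborel)"
  shows "(\<integral>\<^sup>+x. ennpow (s x) p \<partial>lborel) \<le>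
    ennreal (20 * p * 4 powr (p - 1) / (p - 1)) * (\<integral>\<^sup>+x. ennpow (h x) p \<partial>lborel)"
proof -
  have [measurable]: "(\<lambda>c. ennpow c p) \<in> borel_measurable borel"
    unfolding ennpow_def[abs_def] by measurable
  let ?w = "\<lambda>t. ennreal (p * t powr (p - 1))"
  have "(\<integral>\<^sup>+x. ennpow (s x) p \<partial>lborel) \<le>
      (\<integral>\<^sup>+x. \<integral>\<^sup>+t. (if 0 < t \<and> ennreal t < s x then ?w t else 0) \<partial>lborel \<partial>lborel)"
    by (intro nn_integral_mono ennpow_le_layers[OF p])
  also have "\<dots> = (\<integral>\<^sup>+t. \<integral>\<^sup>+x. (if 0 < t \<and> ennreal t < s x then ?w t else 0) \<partial>lborel \<partial>lborel)"
    by (rule lborel_pair.Fubini') measurable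
  also have "\<dots> \<le> (\<integral>\<^sup>+t. \<integral>\<^sup>+y. (if 0 < t then ?w t * (ennreal (20 / t) * (h y * (if ennreal (t / 4) < h y then 1 else 0))) else 0) \<partial>lborel \<partial>lborel)"
  proof (rule nn_integral_mono)
    fix t :: real
    show "(\<integral>\<^sup>+x. (if 0 < t \<and> ennreal t < s x then ?w t else 0) \<partial>lborel) \<le>
      (\<integral>\<^sup>+y. (if 0 < t then ?w t * (ennreal (20 / t) * (h y * (if ennreal (t / 4) < h y then 1 else 0))) else 0) \<partial>lborel)"
    proof (cases "0 < t")
      case True
      have "(\<integral>\<^sup>+x. (if 0 < t \<and> ennreal t < s x then ?w t else 0) \<partial>lborel)
         = (\<integral>\<^sup>+x. ?w t * indicator {x. ennreal t < s x} x \<partial>lborel)"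
        using True by (intro nn_integral_cong) (auto simp: indicator_def)
      also have "\<dots> = ?w t * emeasure lborel {x. ennreal t < s x}"
        by (rule nn_integral_cmult_indicator) simp
      also have "\<dots> \<le> ?w t * (ennreal (20 / t) * (\<integral>\<^sup>+y. h y * indicator {y. ennreal (t / 4) < h y} y \<partial>lborel))"
        by (intro mult_left_mono weak_type_maximal max True) auto
      also have "\<dots> = (\<integral>\<^sup>+y. ?w t * (ennreal (20 / t) * (h y * indicator {y. ennreal (t / 4) < h y} y)) \<partial>lborel)"
        by (simp add: nn_integral_cmult)
      also have "\<dots> = (\<integral>\<^sup>+y. (if 0 < t then ?w t * (ennreal (20 / t) * (h y * (if ennreal (t / 4) < h y then 1 else 0))) else 0) \<partial>lborel)"
        using True by (intro nn_integral_cong) (auto simp: indicator_def)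
      finally show ?thesis .
    qed simp
  qed
  also have "\<dots> = (\<integral>\<^sup>+y. \<integral>\<^sup>+t. (if 0 < t then ?w t * (ennreal (20 / t) * (h y * (if ennreal (t / 4) < h y then 1 else 0))) else 0) \<partial>lborel \<partial>lborel)"
    by (rule lborel_pair.Fubini') measurable
  also have "\<dots> \<le> (\<integral>\<^sup>+y. ennreal (20 * p * 4 powr (p - 1) / (p - 1)) * ennpow (h y) p \<partial>lborel)"
    by (intro nn_integral_mono layers_le_ennpow[OF p])
  also have "\<dots> = ennreal (20 * p * 4 powr (p - 1) / (p - 1)) * (\<integral>\<^sup>+y. ennpow (h y) p \<partial>lborel)"
    by (rule nn_integral_cmult) measurable
  finally show ?thesis .
qed

section \<open>Divided differences and spline interpolation\<close>

text \<open>Carrying all derivatives explicitly lets them be combined, and passed to limits, order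
  by order. Iterates of \<open>deriv\<close> are recovered at the end through
  \<open>deriv_family_funpow_deriv\<close>.\<close>

definition deriv_family :: "nat \<Rightarrow> (nat \<Rightarrow> real \<Rightarrow> real) \<Rightarrow> bool" where
  "deriv_family n D \<longleftrightarrow> (\<forall>j<n. \<forall>x. (D j has_real_derivative D (Suc j) x) (at x))"

lemma deriv_familyD: "deriv_family n D \<Longrightarrow> j < n \<Longrightarrow> (D j has_real_derivative D (Suc j) x) (at x)"
  by (simp add: deriv_family_def)

lemma deriv_family_poly: "deriv_family n (\<lambda>j. poly ((pderiv ^^ j) q))"
  by (simp add: deriv_family_def poly_DERIV)

lemma deriv_family_le: "deriv_family n D \<Longrightarrow> k \<le> n \<Longrightarrow> deriv_family k D"
  by (simp add: deriv_family_def)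

lemma deriv_family_add_cmult:
  "deriv_family n D \<Longrightarrow> deriv_family n G \<Longrightarrow> deriv_family n (\<lambda>j x. D j x + c * G j x)"
  unfolding deriv_family_def by (auto intro!: derivative_eq_intros)

section \<open>Rolle's theorem, interpolation polynomials and the mean value theorem\<close>

lemma higher_pderiv_degree_le:
  fixes q :: "real poly"
  assumes "degree q \<le> k"
  shows "(pderiv ^^ k) q = [:fact k * coeff q k:]"
proof (rule poly_eqI)
  fix n
  show "coeff ((pderiv ^^ k) q) n = coeff [:fact k * coeff q k:] n"
    using assms by (cases n) (auto simp: coeff_higher_pderiv pochhammer_fact[symmetric] coeff_eq_0)
qed

lemma higher_pderiv_eq_0:
  fixes q :: "real poly"
  assumes "degree q < k"
  shows "(pderiv ^^ k) q = 0"
  using higher_pderiv_degree_le[of q k] assms by (simp add: coeff_eq_0)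

text \<open>The largest zero is split off. Induction keeps the zeros of \<open>u'\<close> already
  found at or to the left of the second largest zero, so the one given by Rolle's theorem in the
  last gap is new.\<close>

lemma rolle_zeros:
  fixes u u' :: "real \<Rightarrow> real"
  assumes der: "\<And>x. (u has_real_derivative u' x) (at x)"
    and "finite S" "S \<subseteq> {a..b}" "card S = Suc n" "\<And>x. x \<in> S \<Longrightarrow> u x = 0"
  shows "\<exists>S'. finite S' \<and> S' \<subseteq> {a..b} \<and> card S' = n \<and> (\<forall>x\<in>S'. u' x = 0)"
  using assms(2-)
proof (induction n arbitrary: S b)
  case 0
  show ?case by (rule exI[of _ "{}"]) simp
next
  case (Suc n)
  define M where "M = Max S"
  have M: "M \<in> S" unfolding M_def using Suc.prems by (intro Max_in) auto
  define S0 where "S0 = S - {M}"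
  have S0: "finite S0" "card S0 = Suc n" using Suc.prems M by (auto simp: S0_def)
  define m0 where "m0 = Max S0"
  have m0: "m0 \<in> S0" unfolding m0_def using S0 by (intro Max_in) auto
  have less: "m0 < M" using m0 Suc.prems(1) by (auto simp: S0_def M_def less_le)
  have "S0 \<subseteq> {a..m0}"
  proof
    fix y assume "y \<in> S0"
    then have "y \<le> m0" "y \<in> S" using S0(1) by (auto simp: m0_def) (auto simp: S0_def)
    then show "y \<in> {a..m0}" using Suc.prems(2) by auto
  qed
  then obtain S' where S': "finite S'" "S' \<subseteq> {a..m0}" "card S' = n" "\<forall>x\<in>S'. u' x = 0"
    using Suc.IH[of S0 m0] S0 Suc.prems(4) by (auto simp: S0_def)
  have "u m0 = u M" using Suc.prems(4) m0 M by (simp add: S0_def)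
  moreover have "continuous_on {m0..M} u"
    using der by (meson DERIV_atLeastAtMost_imp_continuous_on)
  moreover have "u differentiable (at x)" for x using der real_differentiable_def by blast
  ultimately obtain z where z: "m0 < z" "z < M" "(u has_real_derivative 0) (at z)"
    using Rolle[of m0 M u] less by blast
  have "u' z = 0" using DERIV_unique[OF der z(3)] .
  moreover have "z \<notin> S'" using S'(2) z by auto
  moreover have "a \<le> m0" "M \<le> b" using m0 M Suc.prems(2) by (auto simp: S0_def)
  ultimately show ?case using S' z by (intro exI[of _ "insert z S'"]) auto
qed

lemma rolle_family:
  assumes "deriv_family k D" "finite S" "S \<subseteq> {a..b}" "card S = Suc k" "\<And>x. x \<in> S \<Longrightarrow> D 0 x = 0"
  shows "\<exists>z\<in>{a..b}. D k z = 0"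
  using assms
proof (induction k arbitrary: D S)
  case 0
  then show ?case by (metis card_1_singletonE One_nat_def insertI1 subsetD)
next
  case (Suc k)
  obtain S' where "finite S'" "S' \<subseteq> {a..b}" "card S' = Suc k" "\<forall>x\<in>S'. D (Suc 0) x = 0"
    using rolle_zeros[OF deriv_familyD[OF Suc.prems(1)] Suc.prems(2-5)] by auto
  moreover have "deriv_family k (\<lambda>j. D (Suc j))" using Suc.prems(1) by (simp add: deriv_family_def)
  ultimately show ?case using Suc.IH[of "\<lambda>j. D (Suc j)" S'] by auto
qed

lemma lagrange_poly_props:
  assumes "card S = Suc k"
  shows "degree (lagrange_poly k f S) \<le> k" "x \<in> S \<Longrightarrow> poly (lagrange_poly k f S) x = f x"
  using theI'[OF lagrange_poly_ex1[OF assms]] unfolding lagrange_poly_def by auto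

lemma lagrange_poly_unique:
  assumes "card S = Suc k" "degree q \<le> k" "\<And>x. x \<in> S \<Longrightarrow> poly q x = f x"
  shows "lagrange_poly k f S = q"
  unfolding lagrange_poly_def by (rule the1_equality[OF lagrange_poly_ex1[OF assms(1)]]) (use assms in auto)

text \<open>The difference between \<open>D 0\<close> and the interpolation polynomial has
  \<open>k + 1\<close> zeros, so its derivative of order \<open>k\<close> has one. The polynomial
  contributes the constant \<open>fact k\<close> times its coefficient of degree
  \<open>k\<close>.\<close>

lemma divided_diff_mean_value:
  assumes D: "deriv_family k D" and S: "card S = Suc k" "S \<subseteq> {a..b}" and f: "\<And>x. x \<in> S \<Longrightarrow> f x = D 0 x"
  obtains z where "z \<in> {a..b}" "divided_diff k f S = D k z / fact k"
proof -
  let ?q = "lagrange_poly k f S"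
  let ?E = "\<lambda>j x. D j x + (- 1) * poly ((pderiv ^^ j) ?q) x"
  have "\<exists>z\<in>{a..b}. ?E k z = 0"
  proof (rule rolle_family[of k ?E S])
    show "deriv_family k ?E" by (rule deriv_family_add_cmult[OF D deriv_family_poly])
    show "finite S" using S(1) card.infinite by fastforce
    show "?E 0 x = 0" if "x \<in> S" for x using lagrange_poly_props(2)[OF S(1) that] f[OF that] by simp
  qed (use S in auto)
  then obtain z where z: "z \<in> {a..b}" "?E k z = 0" by blast
  have "divided_diff k f S = D k z / fact k"
    using z(2) higher_pderiv_degree_le[OF lagrange_poly_props(1)[OF S(1)]] by (simp add: divided_diff_def field_simps)
  with z(1) show ?thesis by (rule that)
qed

section \<open>Smooth steps and cut-off root polynomials\<close>

lemma antiderivative_exists: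
  fixes f :: "real \<Rightarrow> real"
  assumes "continuous_on UNIV f"
  obtains F where "\<And>x. (F has_real_derivative f x) (at x)"
proof -
  have "\<exists>F. \<forall>x::real. -\<infinity> < ereal x \<longrightarrow> ereal x < \<infinity> \<longrightarrow> (F has_vector_derivative f x) (at x)"
    by (rule einterval_antiderivative) (use assms in \<open>auto simp: continuous_on_eq_continuous_at\<close>)
  then show ?thesis using that by (auto simp: has_real_derivative_iff_has_vector_derivative)
qed

text \<open>The step is fixed once for each \<open>m\<close>, and all later cutoffs are rescalings
  of it; a single bound \<open>B\<close> on its derivatives is therefore what keeps constants
  dependent on \<open>m\<close> only. The induction starts from a clamped linear ramp.\<close>

lemma smooth_step:
  shows "\<exists>S B. deriv_family m S \<and> continuous_on UNIV (S 0) \<and> (\<forall>j\<le>m. \<forall>x. \<bar>S j x\<bar> \<le> B) \<and>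
    (\<forall>j\<le>m. \<forall>x\<le>0. S j x = 0) \<and> (\<forall>j\<le>m. \<forall>x\<ge>1. S j x = (if j = 0 then 1 else 0 :: real))"
proof (induction m)
  case 0
  have "continuous_on UNIV (\<lambda>x. max 0 (min 1 x) :: real)" by (intro continuous_intros)
  then show ?case
    by (intro exI[of _ "\<lambda>_ x. max 0 (min 1 x)"] exI[of _ 1]) (auto simp: deriv_family_def)
next
  case (Suc m)
  then obtain S B where S: "deriv_family m S" "continuous_on UNIV (S 0)" "\<And>j x. j \<le> m \<Longrightarrow> \<bar>S j x\<bar> \<le> B"
    "\<And>j x. j \<le> m \<Longrightarrow> x \<le> 0 \<Longrightarrow> S j x = 0"
    "\<And>j x. j \<le> m \<Longrightarrow> x \<ge> 1 \<Longrightarrow> S j x = (if j = 0 then 1 else 0)"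
    by metis
  obtain A where A: "\<And>x. (A has_real_derivative S 0 x) (at x)" using antiderivative_exists[OF S(2)] by metis
  \<comment> \<open>Averaging \<open>S 0\<close> over \<open>[2x - 1, 2x]\<close> gains one derivative.\<close>
  define S' where "S' j x = (case j of 0 \<Rightarrow> A (2 * x) - A (2 * x - 1)
     | Suc i \<Rightarrow> 2 ^ Suc i * (S i (2 * x) - S i (2 * x - 1)))" for j x
  \<comment> \<open>An average over a unit interval is a value taken there, so the bound and both
    plateaus of \<open>S 0\<close> pass to \<open>S' 0\<close>.\<close>
  have A': "\<exists>z. 2 * x - 1 < z \<and> z < 2 * x \<and> S' 0 x = S 0 z" for x
    using MVT2[of "2 * x - 1" "2 * x" A "S 0"] A by (auto simp: S'_def)
  have B: "0 \<le> B" using S(3)[of 0 0] by simp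
  have fam: "deriv_family (Suc m) S'"
    unfolding deriv_family_def
  proof (intro allI impI)
    fix j x assume j: "j < Suc m"
    show "(S' j has_real_derivative S' (Suc j) x) (at x)"
    proof (cases j)
      case 0
      have "((\<lambda>x. A (2 * x) - A (2 * x - 1)) has_real_derivative (S 0 (2 * x) * 2 - S 0 (2 * x - 1) * 2)) (at x)"
        by (intro DERIV_diff DERIV_chain2[OF A]) (auto intro!: derivative_eq_intros)
      then show ?thesis by (simp add: 0 S'_def[abs_def] algebra_simps)
    next
      case (Suc i)
      have d: "(S i has_real_derivative S (Suc i) y) (at y)" for y
        using S(1) j Suc by (simp add: deriv_family_def)
      have "((\<lambda>x. 2 ^ Suc i * (S i (2 * x) - S i (2 * x - 1))) has_real_derivative
          2 ^ Suc i * (S (Suc i) (2 * x) * 2 - S (Suc i) (2 * x - 1) * 2)) (at x)"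
        by (intro DERIV_cmult DERIV_diff DERIV_chain2[OF d]) (auto intro!: derivative_eq_intros)
      then show ?thesis by (simp add: Suc S'_def[abs_def] algebra_simps)
    qed
  qed
  show ?case
  proof (intro exI[of _ S'] exI[of _ "2 ^ Suc m * (2 * B)"] conjI allI impI)
    show "deriv_family (Suc m) S'" by (rule fam)
    show "continuous_on UNIV (S' 0)"
      using deriv_familyD[OF fam, of 0] by (intro DERIV_continuous_on) (auto intro: has_field_derivative_at_within)
  next
    fix j x assume j: "j \<le> Suc m"
    show "\<bar>S' j x\<bar> \<le> 2 ^ Suc m * (2 * B)"
    proof (cases j)
      case 0
      obtain z where "S' 0 x = S 0 z" using A' by blast
      then have "\<bar>S' 0 x\<bar> \<le> 1 * B" using S(3)[of 0 z] by simp
      also have "\<dots> \<le> 2 ^ Suc m * (2 * B)"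
        using B one_le_power[of "2 :: real" "Suc m"] by (intro mult_mono) auto
      finally show ?thesis using 0 by simp
    next
      case (Suc i)
      have "\<bar>S' j x\<bar> = 2 ^ Suc i * \<bar>S i (2 * x) - S i (2 * x - 1)\<bar>"
        by (simp add: Suc S'_def abs_mult)
      also have "\<dots> \<le> 2 ^ Suc m * (2 * B)"
        using S(3)[of i "2 * x"] S(3)[of i "2 * x - 1"] j Suc
        by (intro mult_mono power_increasing) auto
      finally show ?thesis .
    qed
  next
    fix j x assume j: "j \<le> Suc m" and x: "x \<le> (0 :: real)"
    show "S' j x = 0"
    proof (cases j)
      case 0
      obtain z where "z < 2 * x" "S' 0 x = S 0 z" using A' by blast
      then show ?thesis using S(4)[of 0 z] x 0 by simp
    qed (use x j S(4) in \<open>simp add: S'_def\<close>)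
  next
    fix j x assume j: "j \<le> Suc m" and x: "x \<ge> (1 :: real)"
    show "S' j x = (if j = 0 then 1 else 0)"
    proof (cases j)
      case 0
      obtain z where "2 * x - 1 < z" "S' 0 x = S 0 z" using A' by blast
      then show ?thesis using S(5)[of 0 z] x 0 by simp
    qed (use x j S(5) in \<open>simp add: S'_def\<close>)
  qed
qed

text \<open>At \<open>j = 0\<close> the truncated \<open>j - 1\<close> is harmless, since its
  coefficient \<open>real j\<close> vanishes.\<close>

lemma higher_pderiv_linear_mult:
  fixes q :: "real poly"
  shows "(pderiv ^^ j) ([:- z, 1:] * q) = [:- z, 1:] * (pderiv ^^ j) q + smult (real j) ((pderiv ^^ (j - 1)) q)"
proof (induction j)
  case (Suc j)
  have eq: "smult (real j) (pderiv ((pderiv ^^ (j - 1)) q)) = smult (real j) ((pderiv ^^ j) q)"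
    by (cases j) auto
  have "pderiv ([:- z, 1:] * A) = [:- z, 1:] * pderiv A + A" for A :: "real poly"
    by (subst pderiv_mult) (simp add: pderiv_pCons)
  then have "(pderiv ^^ Suc j) ([:- z, 1:] * q) =
      ([:- z, 1:] * pderiv ((pderiv ^^ j) q) + (pderiv ^^ j) q) + smult (real j) ((pderiv ^^ j) q)"
    unfolding funpow.simps o_apply Suc pderiv_add pderiv_smult eq by simp
  also have "\<dots> = [:- z, 1:] * (pderiv ^^ Suc j) q + smult (real (Suc j)) ((pderiv ^^ j) q)"
    by (simp only: funpow.simps o_apply of_nat_Suc smult_add_left smult_1_left add.assoc)
  finally show ?case by simp
qed simp

abbreviation root_poly :: "real set \<Rightarrow> real poly" where
  "root_poly Y \<equiv> (\<Prod>z\<in>Y. [:- z, 1:])"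

text \<open>
  Multiplying in one linear factor \<open>y - z\<close> at a time replaces
  \<open>G\<^sup>(\<^sup>j\<^sup>)\<close> by \<open>(y - z) G\<^sup>(\<^sup>j\<^sup>) + j G\<^sup>(\<^sup>j\<^sup>-\<^sup>1\<^sup>)\<close>, so no general Leibniz rule is needed.
\<close>

lemma smooth_cutoff_root_poly:
  assumes m: "1 \<le> m"
  obtains C where "0 \<le> C" "\<And>Y u v \<alpha> \<beta>. finite Y \<Longrightarrow> card Y = m - 1 \<Longrightarrow> Y \<subseteq> {u..v} \<Longrightarrow> u \<le> \<alpha> \<Longrightarrow> \<alpha> < \<beta> \<Longrightarrow> \<beta> \<le> v \<Longrightarrow>
      v - u \<le> real m * (\<beta> - \<alpha>) \<Longrightarrow>
    \<exists>G. deriv_family m G \<and> (\<forall>y\<le>\<alpha>. G 0 y = 0) \<and> (\<forall>y\<ge>\<beta>. G 0 y = poly (root_poly Y) y) \<and>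
      (\<forall>y\<in>Y. G 0 y = 0) \<and> (\<forall>y. y \<notin> {u..v} \<longrightarrow> G m y = 0) \<and> (\<forall>y\<in>{u..v}. \<bar>G m y\<bar> \<le> C / (v - u))"
proof -
  obtain S B where S: "deriv_family m S" "\<And>j x. j \<le> m \<Longrightarrow> \<bar>S j x\<bar> \<le> B"
    "\<And>j x. j \<le> m \<Longrightarrow> x \<le> 0 \<Longrightarrow> S j x = 0"
    "\<And>j x. j \<le> m \<Longrightarrow> x \<ge> 1 \<Longrightarrow> S j x = (if j = 0 then 1 else 0)"
    using smooth_step[of m] by metis
  have B: "0 \<le> B" using S(2)[of 0 0] by simp
  \<comment> \<open>The gap is at least the m-th part of [u, v], so each derivative of the rescaled
    step costs at most a factor \<open>m\<close> relative to the scale \<open>v - u\<close>, whence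
    \<open>m ^ m\<close>. Each of the \<open>m - 1\<close> linear factors in \<open>C\<close> then
    costs \<open>(m + 1) * L\<close>: \<open>L\<close> from the factor \<open>y - z\<close> and
    \<open>m * L\<close> from the derivative of lower order.\<close>
  define K where "K = B * real m ^ m"
  define C where "C = K * (real m + 1) ^ (m - 1)"
  have K: "0 \<le> K" using B by (simp add: K_def)
  show ?thesis
  proof (rule that[of C])
    show "0 \<le> C" using K by (simp add: C_def)
  next
    fix Y :: "real set" and u v \<alpha> \<beta> :: real
    assume Y: "finite Y" "card Y = m - 1" "Y \<subseteq> {u..v}" and \<alpha>\<beta>: "u \<le> \<alpha>" "\<alpha> < \<beta>" "\<beta> \<le> v" "v - u \<le> real m * (\<beta> - \<alpha>)"
    define L where "L = v - u"
    have L: "L > 0" using \<alpha>\<beta> by (simp add: L_def)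
    \<comment> \<open>With the weight \<open>L ^ j\<close> one bound covers all orders
      \<open>j\<close>, which the recursion mixes. At order \<open>m\<close> with
      \<open>m - 1\<close> roots the powers of \<open>L\<close> reduce to the desired
      \<open>1 / L\<close>.\<close>
    have "\<exists>G. deriv_family m G \<and> (\<forall>j\<le>m. \<forall>y\<le>\<alpha>. G j y = 0) \<and>
       (\<forall>j\<le>m. \<forall>y\<ge>\<beta>. G j y = poly ((pderiv ^^ j) (root_poly Y)) y) \<and> (\<forall>y\<in>Y. G 0 y = 0) \<and>
       (\<forall>j\<le>m. \<forall>y\<in>{u..v}. \<bar>G j y\<bar> * L ^ j \<le> K * ((real m + 1) * L) ^ card Y)"
      using Y(1,3)
    proof (induction Y)
      case empty
      define G where "G j y = S j ((y - \<alpha>) / (\<beta> - \<alpha>)) / (\<beta> - \<alpha>) ^ j" for j y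
      have "deriv_family m G"
        unfolding deriv_family_def
      proof (intro allI impI)
        fix j y assume "j < m"
        have "((\<lambda>y. S j ((y - \<alpha>) / (\<beta> - \<alpha>)) / (\<beta> - \<alpha>) ^ j) has_real_derivative
            (S (Suc j) ((y - \<alpha>) / (\<beta> - \<alpha>)) * (1 / (\<beta> - \<alpha>))) / (\<beta> - \<alpha>) ^ j) (at y)"
          by (intro DERIV_cdivide DERIV_chain2[OF deriv_familyD[OF S(1) \<open>j < m\<close>]])
             (auto intro!: derivative_eq_intros)
        then show "(G j has_real_derivative G (Suc j) y) (at y)"
          by (simp add: G_def[abs_def])
      qed
      moreover have "\<forall>j\<le>m. \<forall>y\<le>\<alpha>. G j y = 0"
        using \<alpha>\<beta> by (auto simp: G_def divide_nonpos_pos intro!: S(3))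
      moreover have "\<forall>j\<le>m. \<forall>y\<ge>\<beta>. G j y = poly ((pderiv ^^ j) (root_poly {})) y"
      proof (intro allI impI)
        fix j y assume j: "j \<le> m" and y: "y \<ge> \<beta>"
        have "(y - \<alpha>) / (\<beta> - \<alpha>) \<ge> 1" using \<alpha>\<beta> y by simp
        moreover have "(pderiv ^^ j) (1 :: real poly) = 0" if "0 < j" using that by (intro higher_pderiv_eq_0) simp
        ultimately show "G j y = poly ((pderiv ^^ j) (root_poly {})) y" using j by (auto simp: G_def S(4))
      qed
      moreover have "\<bar>G j y\<bar> * L ^ j \<le> K" if j: "j \<le> m" for j y
      proof -
        have "\<bar>G j y\<bar> * L ^ j = \<bar>S j ((y - \<alpha>) / (\<beta> - \<alpha>))\<bar> * (L / (\<beta> - \<alpha>)) ^ j"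
          using \<alpha>\<beta> by (simp add: G_def abs_mult power_divide)
        also have "\<dots> \<le> B * real m ^ j"
          using \<alpha>\<beta> L B S(2)[OF j] by (intro mult_mono power_mono) (auto simp: L_def field_simps)
        also have "\<dots> \<le> K" unfolding K_def using B m j by (intro mult_left_mono power_increasing) auto
        finally show ?thesis .
      qed
      ultimately show ?case by (intro exI[of _ G]) simp
    next
      case (insert z Y)
      have sub: "Y \<subseteq> {u..v}" using insert.prems by simp
      obtain G where G: "deriv_family m G" "\<And>j y. j \<le> m \<Longrightarrow> y \<le> \<alpha> \<Longrightarrow> G j y = 0"
        "\<And>j y. j \<le> m \<Longrightarrow> y \<ge> \<beta> \<Longrightarrow> G j y = poly ((pderiv ^^ j) (root_poly Y)) y" "\<And>y. y \<in> Y \<Longrightarrow> G 0 y = 0"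
        "\<And>j y. j \<le> m \<Longrightarrow> y \<in> {u..v} \<Longrightarrow> \<bar>G j y\<bar> * L ^ j \<le> K * ((real m + 1) * L) ^ card Y"
        using insert.IH[OF sub] by blast
      define H where "H j y = (y - z) * G j y + real j * G (j - 1) y" for j y
      have "deriv_family m H"
        unfolding deriv_family_def
      proof (intro allI impI)
        fix j y assume j: "j < m"
        have 1: "((\<lambda>y. (y - z) * G j y) has_real_derivative (1 * G j y + G (Suc j) y * (y - z))) (at y)"
          by (intro DERIV_mult deriv_familyD[OF G(1) j]) (auto intro!: derivative_eq_intros)
        have 2: "((\<lambda>y. real j * G (j - 1) y) has_real_derivative (real j * G j y)) (at y)"
          using deriv_familyD[OF G(1), of "j - 1" y] j by (cases j) (auto intro!: DERIV_cmult)
        show "(H j has_real_derivative H (Suc j) y) (at y)"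
          using DERIV_add[OF 1 2] by (simp add: H_def[abs_def] algebra_simps)
      qed
      moreover have "\<forall>j\<le>m. \<forall>y\<le>\<alpha>. H j y = 0" by (auto simp: H_def G(2))
      moreover have "\<forall>j\<le>m. \<forall>y\<ge>\<beta>. H j y = poly ((pderiv ^^ j) (root_poly (insert z Y))) y"
      proof (intro allI impI)
        fix j y assume j: "j \<le> m" and y: "y \<ge> \<beta>"
        have "poly ((pderiv ^^ j) (root_poly (insert z Y))) y
          = poly ((pderiv ^^ j) ([:- z, 1:] * root_poly Y)) y" using insert.hyps by simp
        also have "\<dots> = (y - z) * poly ((pderiv ^^ j) (root_poly Y)) y + real j * poly ((pderiv ^^ (j - 1)) (root_poly Y)) y"
          unfolding higher_pderiv_linear_mult by (simp add: algebra_simps)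
        also have "\<dots> = H j y" using G(3)[OF j y] G(3)[of "j - 1", OF _ y] j by (simp add: H_def)
        finally show "H j y = poly ((pderiv ^^ j) (root_poly (insert z Y))) y" ..
      qed
      moreover have "\<forall>y\<in>insert z Y. H 0 y = 0" by (auto simp: H_def G(4))
      moreover have "\<bar>H j y\<bar> * L ^ j \<le> K * ((real m + 1) * L) ^ card (insert z Y)" if j: "j \<le> m" and y: "y \<in> {u..v}" for j y
      proof -
        let ?R = "K * ((real m + 1) * L) ^ card Y"
        have R: "0 \<le> ?R" using K L by simp
        have "\<bar>(y - z) * G j y\<bar> * L ^ j = \<bar>y - z\<bar> * (\<bar>G j y\<bar> * L ^ j)" by (simp add: abs_mult)
        also have "\<dots> \<le> L * ?R"
          using insert.prems y L by (intro mult_mono[OF _ G(5)[OF j y]]) (auto simp: L_def)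
        finally have 1: "\<bar>(y - z) * G j y\<bar> * L ^ j \<le> L * ?R" .
        have "\<bar>real j * G (j - 1) y\<bar> * L ^ j = real j * L * (\<bar>G (j - 1) y\<bar> * L ^ (j - 1))"
          by (cases j) (auto simp: abs_mult)
        also have "\<dots> \<le> real m * L * ?R"
          using j L by (intro mult_mono[OF _ G(5)[OF _ y]]) auto
        finally have 2: "\<bar>real j * G (j - 1) y\<bar> * L ^ j \<le> real m * L * ?R" .
        have "\<bar>H j y\<bar> * L ^ j \<le> (\<bar>(y - z) * G j y\<bar> + \<bar>real j * G (j - 1) y\<bar>) * L ^ j"
          unfolding H_def using L by (intro mult_right_mono abs_triangle_ineq) auto
        also have "\<dots> \<le> L * ?R + real m * L * ?R" using 1 2 by (simp add: distrib_right)
        also have "\<dots> = K * ((real m + 1) * L) ^ card (insert z Y)"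
          using insert.hyps by (simp add: algebra_simps)
        finally show ?thesis .
      qed
      ultimately show ?case by (intro exI[of _ H]) simp
    qed
    then obtain G where G: "deriv_family m G" "\<And>j y. j \<le> m \<Longrightarrow> y \<le> \<alpha> \<Longrightarrow> G j y = 0"
        "\<And>j y. j \<le> m \<Longrightarrow> y \<ge> \<beta> \<Longrightarrow> G j y = poly ((pderiv ^^ j) (root_poly Y)) y" "\<And>y. y \<in> Y \<Longrightarrow> G 0 y = 0"
        "\<And>j y. j \<le> m \<Longrightarrow> y \<in> {u..v} \<Longrightarrow> \<bar>G j y\<bar> * L ^ j \<le> K * ((real m + 1) * L) ^ card Y"
      by blast
    have deg: "degree (root_poly Y) = card Y"
      by (subst degree_prod_eq_sum_degree) auto
    \<comment> \<open>To the left of the gap \<open>G\<close> is zero and to the right it is a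
      polynomial of degree \<open>m - 1\<close>, so its derivative of order \<open>m\<close>
      vanishes outside [u, v].\<close>
    then have "(pderiv ^^ m) (root_poly Y) = 0"
      using Y m by (intro higher_pderiv_eq_0) simp
    then have out: "G m y = 0" if "y \<notin> {u..v}" for y
      using that G(2)[of m y] G(3)[of m y] \<alpha>\<beta> by (cases "y < u") auto
    have "\<bar>G m y\<bar> \<le> C / (v - u)" if "y \<in> {u..v}" for y
    proof -
      have "\<bar>G m y\<bar> * L ^ m \<le> C * L ^ (m - 1)"
        using G(5)[OF _ that, of m] Y by (simp add: C_def power_mult_distrib)
      moreover have "L ^ m = L * L ^ (m - 1)" using m by (cases m) auto
      ultimately have "\<bar>G m y\<bar> * L \<le> C" using L by (simp add: mult.assoc[symmetric])
      then show ?thesis using L by (simp add: L_def field_simps)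
    qed
    then show "\<exists>G. deriv_family m G \<and> (\<forall>y\<le>\<alpha>. G 0 y = 0) \<and> (\<forall>y\<ge>\<beta>. G 0 y = poly (root_poly Y) y) \<and>
      (\<forall>y\<in>Y. G 0 y = 0) \<and> (\<forall>y. y \<notin> {u..v} \<longrightarrow> G m y = 0) \<and> (\<forall>y\<in>{u..v}. \<bar>G m y\<bar> \<le> C / (v - u))"
      using G out by (intro exI[of _ G]) auto
  qed
qed

section \<open>De Boor's interpolant on a finite set\<close>

lemma large_gap:
  fixes x :: "nat \<Rightarrow> real"
  assumes m: "1 \<le> m"
  obtains j where "i \<le> j" "j < i + m" "x (i + m) - x i \<le> real m * (x (Suc j) - x j)"
proof (rule ccontr)
  assume "\<not> thesis"
  then have less: "real m * (x (Suc j) - x j) < x (i + m) - x i" if "j \<in> {i..<i + m}" for j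
    using that \<open>\<And>j. \<lbrakk>i \<le> j; j < i + m; x (i + m) - x i \<le> real m * (x (Suc j) - x j)\<rbrakk> \<Longrightarrow> thesis\<close> by force
  have "real m * (x (i + m) - x i) = (\<Sum>j\<in>{i..<i + m}. real m * (x (Suc j) - x j))"
    by (simp add: sum_distrib_left[symmetric] sum_Suc_diff')
  also have "\<dots> < (\<Sum>j\<in>{i..<i + m}. x (i + m) - x i)"
    using m less by (intro sum_strict_mono) auto
  also have "\<dots> = real m * (x (i + m) - x i)" by simp
  finally show False by simp
qed

text \<open>Induction on the points, with the invariant that from the last point on the interpolant
  equals the polynomial through the last \<open>m\<close> points. Passing to the next point changes
  this polynomial by a multiple of \<open>root_poly Y\<close>, where \<open>Y\<close> consists of
  the \<open>m - 1\<close> common nodes; the cut-off correction adds just that multiple beyond the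
  gap.\<close>

lemma spline_interpolation:
  assumes m: "1 \<le> m"
  obtains C where "0 \<le> C" "\<And>n (x :: nat \<Rightarrow> real) f. m \<le> Suc n \<Longrightarrow> strict_mono_on {0..n} x \<Longrightarrow>
    \<exists>D. deriv_family m D \<and> (\<forall>k\<le>n. D 0 (x k) = f (x k)) \<and>
      (\<forall>y. \<bar>D m y\<bar> \<le> (\<Sum>i\<in>{i. i + m \<le> n}. if y \<in> {x i..x (i + m)} then
        C * (\<bar>divided_diff (m - 1) f (x ` {i..i + m - 1}) - divided_diff (m - 1) f (x ` {Suc i..i + m})\<bar> / (x (i + m) - x i)) else 0))"
proof -
  obtain C where C: "0 \<le> C" "\<And>Y u v \<alpha> \<beta>. finite Y \<Longrightarrow> card Y = m - 1 \<Longrightarrow> Y \<subseteq> {u..v} \<Longrightarrow> u \<le> \<alpha> \<Longrightarrow> \<alpha> < \<beta> \<Longrightarrow> \<beta> \<le> v \<Longrightarrow>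
      v - u \<le> real m * (\<beta> - \<alpha>) \<Longrightarrow>
    \<exists>G. deriv_family m G \<and> (\<forall>y\<le>\<alpha>. G 0 y = 0) \<and> (\<forall>y\<ge>\<beta>. G 0 y = poly (root_poly Y) y) \<and>
      (\<forall>y\<in>Y. G 0 y = 0) \<and> (\<forall>y. y \<notin> {u..v} \<longrightarrow> G m y = 0) \<and> (\<forall>y\<in>{u..v}. \<bar>G m y\<bar> \<le> C / (v - u))"
    using smooth_cutoff_root_poly[OF m] by blast
  show ?thesis
  proof (rule that[OF C(1)])
    fix n :: nat and x :: "nat \<Rightarrow> real" and f :: "real \<Rightarrow> real"
    define c where "c i = \<bar>divided_diff (m - 1) f (x ` {i..i + m - 1}) - divided_diff (m - 1) f (x ` {Suc i..i + m})\<bar>" for i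
    define R where "R n y = (\<Sum>i\<in>{i. i + m \<le> n}. if y \<in> {x i..x (i + m)} then C * (c i / (x (i + m) - x i)) else 0)" for n y
    assume n: "m \<le> Suc n" and x: "strict_mono_on {0..n} x"
    then have "m - 1 \<le> n" by simp
    then have "\<exists>D. deriv_family m D \<and> (\<forall>k\<le>n. D 0 (x k) = f (x k)) \<and>
       (\<forall>y\<ge>x n. D 0 y = poly (lagrange_poly (m - 1) f (x ` {Suc n - m..n})) y) \<and> (\<forall>y. \<bar>D m y\<bar> \<le> R n y)"
      using x
    proof (induction n rule: nat_induct_at_least)
      \<comment> \<open>Here \<open>n = m - 1\<close>: the sum over \<open>i\<close> is empty, and a
        single polynomial of degree below \<open>m\<close> has zero derivative of order
        \<open>m\<close>.\<close>
      case base
      have card: "card (x ` {0..m - 1}) = Suc (m - 1)"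
        using card_image[OF strict_mono_on_imp_inj_on[OF base]] by simp
      let ?q = "lagrange_poly (m - 1) f (x ` {0..m - 1})"
      have "(pderiv ^^ m) ?q = 0"
        using lagrange_poly_props(1)[OF card, of f] m by (intro higher_pderiv_eq_0) simp
      moreover have "0 \<le> R (m - 1) y" for y
        unfolding R_def using C(1) by (auto intro!: sum_nonneg divide_nonneg_nonneg mult_nonneg_nonneg simp: c_def)
      moreover have "poly ?q (x k) = f (x k)" if "k \<le> m - 1" for k
        using lagrange_poly_props(2)[OF card, of "x k" f] that by simp
      moreover have "{Suc (m - 1) - m..m - 1} = {0..m - 1}" using m by auto
      ultimately show ?case
        by (intro exI[of _ "\<lambda>j. poly ((pderiv ^^ j) ?q)"]) (auto simp: deriv_family_poly)
    next
      case (Suc n)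
      define i where "i = Suc n - m"
      have i: "i + m = Suc n" "i \<le> n" using Suc.hyps m by (auto simp: i_def)
      have less: "x j < x k" if "j < k" "k \<le> Suc n" for j k
        using strict_mono_onD[OF Suc.prems, of j k] that by auto
      have le: "x j \<le> x k" if "j \<le> k" "k \<le> Suc n" for j k
        using less[of j k] that by (cases "j = k") auto
      have inj: "inj_on x {0..Suc n}" by (rule strict_mono_on_imp_inj_on[OF Suc.prems])
      have "strict_mono_on {0..n} x" by (rule monotone_on_subset[OF Suc.prems]) auto
      then obtain D where D: "deriv_family m D" "\<And>k. k \<le> n \<Longrightarrow> D 0 (x k) = f (x k)"
        "\<And>y. x n \<le> y \<Longrightarrow> D 0 y = poly (lagrange_poly (m - 1) f (x ` {i..n})) y" "\<And>y. \<bar>D m y\<bar> \<le> R n y"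
        using Suc.IH unfolding i_def by blast
      obtain j where j: "i \<le> j" "j < i + m" "x (i + m) - x i \<le> real m * (x (Suc j) - x j)"
        by (rule large_gap[OF m])
      define Y where "Y = x ` {Suc i..n}"
      have cardY: "card Y = m - 1"
        unfolding Y_def using i by (subst card_image[OF inj_on_subset[OF inj]]) auto
      have "\<exists>G. deriv_family m G \<and> (\<forall>y\<le>x j. G 0 y = 0) \<and> (\<forall>y\<ge>x (Suc j). G 0 y = poly (root_poly Y) y) \<and>
         (\<forall>y\<in>Y. G 0 y = 0) \<and> (\<forall>y. y \<notin> {x i..x (Suc n)} \<longrightarrow> G m y = 0) \<and>
         (\<forall>y\<in>{x i..x (Suc n)}. \<bar>G m y\<bar> \<le> C / (x (Suc n) - x i))"
        using j i cardY by (intro C(2)) (auto simp: Y_def intro!: le less)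
      then obtain G where G: "deriv_family m G" "\<And>y. y \<le> x j \<Longrightarrow> G 0 y = 0"
        "\<And>y. x (Suc j) \<le> y \<Longrightarrow> G 0 y = poly (root_poly Y) y" "\<And>y. y \<in> Y \<Longrightarrow> G 0 y = 0"
        "\<And>y. y \<notin> {x i..x (Suc n)} \<Longrightarrow> G m y = 0"
        "\<And>y. y \<in> {x i..x (Suc n)} \<Longrightarrow> \<bar>G m y\<bar> \<le> C / (x (Suc n) - x i)"
        by blast
      let ?q = "lagrange_poly (m - 1) f (x ` {i..n})" and ?q' = "lagrange_poly (m - 1) f (x ` {Suc i..Suc n})"
      let ?\<psi> = "root_poly Y"
      have card: "card (x ` {i..n}) = Suc (m - 1)" "card (x ` {Suc i..Suc n}) = Suc (m - 1)"
        using i m card_image[OF inj_on_subset[OF inj], of "{i..n}"]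
          card_image[OF inj_on_subset[OF inj], of "{Suc i..Suc n}"] by auto
      have finY: "finite Y" by (simp add: Y_def)
      have "x (Suc n) \<notin> Y"
      proof
        assume "x (Suc n) \<in> Y"
        then obtain k where "k \<le> n" "x (Suc n) = x k" by (auto simp: Y_def)
        then show False using less[of k "Suc n"] by simp
      qed
      then have \<psi>: "poly ?\<psi> (x (Suc n)) \<noteq> 0" using finY by (auto simp: poly_prod)
      have \<psi>0: "poly ?\<psi> y = 0" if "y \<in> Y" for y using that finY by (auto simp: poly_prod)
      have deg\<psi>: "degree ?\<psi> = m - 1"
        by (subst degree_prod_eq_sum_degree) (auto simp: cardY)
      have lead\<psi>: "coeff ?\<psi> (m - 1) = 1"
        using lead_coeff_prod[of "\<lambda>z. [:- z, 1:]" Y] unfolding deg\<psi> by simp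
      \<comment> \<open>Newton's formula: \<open>e\<close> makes the old polynomial pass through the
        new point. As \<open>root_poly Y\<close> is monic of degree \<open>m - 1\<close>,
        \<open>e\<close> is also the difference of the two coefficients of degree
        \<open>m - 1\<close>, that is, of two consecutive divided differences.\<close>
      define e where "e = (f (x (Suc n)) - poly ?q (x (Suc n))) / poly ?\<psi> (x (Suc n))"
      have q': "?q' = ?q + smult e ?\<psi>"
      proof (rule lagrange_poly_unique[OF card(2)])
        show "degree (?q + smult e ?\<psi>) \<le> m - 1"
          using lagrange_poly_props(1)[OF card(1), of f] degree_smult_le[of e ?\<psi>] deg\<psi>
          by (intro degree_add_le) auto
        fix y assume "y \<in> x ` {Suc i..Suc n}"
        then consider "y = x (Suc n)" | "y \<in> Y" unfolding Y_def by (force simp: le_Suc_eq)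
        then show "poly (?q + smult e ?\<psi>) y = f y"
        proof cases
          case 1
          then show ?thesis using \<psi> by (simp add: e_def)
        next
          case 2
          then have "y \<in> x ` {i..n}" by (auto simp: Y_def)
          then show ?thesis using lagrange_poly_props(2)[OF card(1), of y f] \<psi>0[OF 2] by simp
        qed
      qed
      have sets: "{i..i + m - 1} = {i..n}" "{Suc i..i + m} = {Suc i..Suc n}" using i by auto
      have ce: "c i = \<bar>e\<bar>"
        unfolding c_def divided_diff_def sets q' using lead\<psi> by simp
      let ?D = "\<lambda>k y. D k y + e * G k y"
      have "deriv_family m ?D" by (rule deriv_family_add_cmult[OF D(1) G(1)])
      moreover have right: "?D 0 y = poly ?q' y" if "x (Suc n) \<le> y" for y
        using D(3)[of y] G(3)[of y] that le[of n "Suc n"] le[of "Suc j" "Suc n"] j i q' by simp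
      moreover have "?D 0 (x k) = f (x k)" if "k \<le> Suc n" for k
      proof (cases "k = Suc n")
        case True
        have "x (Suc n) \<in> x ` {Suc i..Suc n}" using i by auto
        then show ?thesis using right[of "x (Suc n)"] lagrange_poly_props(2)[OF card(2), of "x (Suc n)" f] True by simp
      next
        case False
        then have "k \<le> n" using that by simp
        \<comment> \<open>Old points up to \<open>x j\<close> lie to the left of the step; those
          after \<open>x j\<close> belong to \<open>Y\<close> because \<open>i \<le> j\<close>. The
          values already interpolated are therefore kept.\<close>
        moreover have "G 0 (x k) = 0"
        proof (cases "k \<le> j")
          case True
          then show ?thesis using j i by (intro G(2) le) auto
        next
          case False
          then show ?thesis using j \<open>k \<le> n\<close> by (intro G(4)) (auto simp: Y_def)
        qed
        ultimately show ?thesis using D(2) by simp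
      qed
      moreover have "\<bar>?D m y\<bar> \<le> R (Suc n) y" for y
      proof -
        have "{i. i + m \<le> Suc n} = insert i {i. i + m \<le> n}" using i by auto
        moreover have "finite {i. i + m \<le> n}" by (rule finite_subset[of _ "{..n}"]) auto
        ultimately have "R (Suc n) y = (if y \<in> {x i..x (Suc n)} then C * (c i / (x (Suc n) - x i)) else 0) + R n y"
          unfolding R_def using i by simp
        moreover have "\<bar>e * G m y\<bar> \<le> (if y \<in> {x i..x (Suc n)} then C * (c i / (x (Suc n) - x i)) else 0)"
          using G(5)[of y] mult_left_mono[OF G(6)[of y], of "\<bar>e\<bar>"] by (auto simp: abs_mult ce mult.commute)
        ultimately show ?thesis using D(4)[of y] by linarith
      qed
      moreover have "Suc (Suc n) - m = Suc i" using i by auto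
      ultimately show ?case by (intro exI[of _ ?D]) simp
    qed
    then show "\<exists>D. deriv_family m D \<and> (\<forall>k\<le>n. D 0 (x k) = f (x k)) \<and>
      (\<forall>y. \<bar>D m y\<bar> \<le> (\<Sum>i\<in>{i. i + m \<le> n}. if y \<in> {x i..x (i + m)} then
        C * (\<bar>divided_diff (m - 1) f (x ` {i..i + m - 1}) - divided_diff (m - 1) f (x ` {Suc i..i + m})\<bar> / (x (i + m) - x i)) else 0))"
      unfolding R_def c_def by blast
  qed
qed

section \<open>From finite sets to arbitrary sets\<close>

lemma deriv_family_funpow_deriv:
  assumes "deriv_family n D" "j \<le> n"
  shows "(deriv ^^ j) (D 0) = D j"
  using assms(2)
proof (induction j)
  case (Suc j)
  have "deriv (D j) x = D (Suc j) x" for x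
    using Suc.prems by (intro DERIV_imp_deriv deriv_familyD[OF assms(1)]) simp
  then show ?case using Suc by auto
qed simp

text \<open>Subtracting the interpolation polynomial on \<open>T0\<close> gives, by Rolle's theorem,
  a zero of every derivative up to order \<open>n\<close> in [-R, R]. The top derivative oscillates
  by at most \<open>h\<close>, and each descent by one order, starting from such a zero, costs a
  factor \<open>2 * R\<close>. The bound is the same for all admissible \<open>D\<close>, as
  compactness requires.\<close>

lemma deriv_family_bounded:
  fixes H :: "real \<Rightarrow> real"
  assumes T0: "finite T0" "card T0 = Suc n" "T0 \<subseteq> {- R..R}"
  obtains M where "0 \<le> M"
    "\<And>D j x. deriv_family n D \<Longrightarrow> (\<And>x. x \<in> T0 \<Longrightarrow> D 0 x = f x) \<Longrightarrow>
      (\<And>a b. a \<le> b \<Longrightarrow> \<bar>D n b - D n a\<bar> \<le> H b - H a) \<Longrightarrow> j \<le> n \<Longrightarrow> x \<in> {- R..R} \<Longrightarrow> \<bar>D j x\<bar> \<le> M"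
proof -
  define q where "q = lagrange_poly n f T0"
  have "\<exists>B\<ge>0. \<forall>x\<in>{- R..R}. \<bar>poly ((pderiv ^^ j) q) x\<bar> \<le> B" for j
  proof -
    have "compact (poly ((pderiv ^^ j) q) ` {- R..R})"
      by (intro compact_continuous_image continuous_intros) auto
    then obtain B where "\<forall>y\<in>poly ((pderiv ^^ j) q) ` {- R..R}. norm y \<le> B"
      using compact_imp_bounded bounded_iff by blast
    then show ?thesis by (intro exI[of _ "max B 0"]) auto
  qed
  then obtain B where B: "\<And>j. 0 \<le> B j" "\<And>j x. x \<in> {- R..R} \<Longrightarrow> \<bar>poly ((pderiv ^^ j) q) x\<bar> \<le> B j" by metis
  define h where "h = \<bar>H R - H (- R)\<bar>"
  have R: "0 \<le> R" using T0 by (cases "T0 = {}") force+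
  define M where "M = (\<Sum>j\<le>n. B j + (2 * R) ^ (n - j) * h)"
  have nonneg: "0 \<le> B j + (2 * R) ^ (n - j) * h" for j using B(1) R by (simp add: h_def)
  show ?thesis
  proof (rule that[of M])
    show "0 \<le> M" unfolding M_def by (intro sum_nonneg nonneg)
    fix D j x
    assume D: "deriv_family n D" "\<And>x. x \<in> T0 \<Longrightarrow> D 0 x = f x"
      "\<And>a b. a \<le> b \<Longrightarrow> \<bar>D n b - D n a\<bar> \<le> H b - H a"
    assume j: "j \<le> n" and x: "x \<in> {- R..R}"
    define u where "u j x = D j x + (- 1) * poly ((pderiv ^^ j) q) x" for j x
    have u: "deriv_family n u"
      unfolding u_def[abs_def] by (rule deriv_family_add_cmult[OF D(1) deriv_family_poly])
    have zero: "\<exists>z\<in>{- R..R}. u j z = 0" if j: "j \<le> n" for j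
    proof -
      obtain S where S: "S \<subseteq> T0" "card S = Suc j" "finite S"
        using obtain_subset_with_card_n[of "Suc j" T0] T0 j by auto
      have "u 0 y = 0" if "y \<in> S" for y
        using lagrange_poly_props(2)[OF T0(2), of y f] D(2)[of y] that S by (auto simp: u_def q_def)
      then show ?thesis using S T0 by (intro rolle_family[OF deriv_family_le[OF u j]]) auto
    qed
    have mono: "H a \<le> H b" if "a \<le> b" for a b using D(3)[OF that] by linarith
    have bound: "\<bar>u (n - i) y\<bar> \<le> (2 * R) ^ i * h" if "i \<le> n" "y \<in> {- R..R}" for i y
      using that
    proof (induction i arbitrary: y)
      case 0
      obtain z where z: "z \<in> {- R..R}" "u n z = 0" using zero[of n] by auto
      have "u n y = D n y - D n z"
        using z(2) higher_pderiv_degree_le[OF lagrange_poly_props(1)[OF T0(2), of f]] by (simp add: u_def q_def)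
      also have "\<bar>D n y - D n z\<bar> \<le> \<bar>H y - H z\<bar>"
        using D(3)[of y z] D(3)[of z y] by (cases "y \<le> z") (auto simp: abs_minus_commute)
      also have "\<dots> \<le> h"
        using z(1) 0 mono[of "- R" y] mono[of "- R" z] mono[of y R] mono[of z R] by (auto simp: h_def)
      finally show ?case by simp
    next
      case (Suc i)
      obtain z where z: "z \<in> {- R..R}" "u (n - Suc i) z = 0" using zero[of "n - Suc i"] by auto
      have der: "(u (n - Suc i) has_real_derivative u (n - i) t) (at t)" for t
        using deriv_familyD[OF u, of "n - Suc i" t] Suc.prems by (simp add: Suc_diff_Suc)
      have "norm (u (n - Suc i) y - u (n - Suc i) z) \<le> (2 * R) ^ i * h * norm (y - z)"
      proof (rule field_differentiable_bound[OF convex_real_interval(5)[of "- R" R]])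
        show "(u (n - Suc i) has_field_derivative u (n - i) t) (at t within {- R..R})" for t
          by (rule has_field_derivative_at_within[OF der])
        show "norm (u (n - i) t) \<le> (2 * R) ^ i * h" if "t \<in> {- R..R}" for t
          using Suc.IH[OF _ that] Suc.prems by simp
      qed (use z Suc.prems in auto)
      also have "\<dots> \<le> (2 * R) ^ i * h * (2 * R)"
        using z(1) Suc.prems R by (intro mult_left_mono) (auto simp: h_def)
      finally show ?case using z(2) by (simp add: mult_ac)
    qed
    have "\<bar>D j x\<bar> \<le> \<bar>poly ((pderiv ^^ j) q) x\<bar> + \<bar>u j x\<bar>" by (simp add: u_def)
    also have "\<dots> \<le> B j + (2 * R) ^ (n - j) * h"
      using B(2)[OF x, of j] bound[of "n - j" x] j x by simp
    also have "\<dots> \<le> M" unfolding M_def using j nonneg by (intro member_le_sum) auto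
    finally show "\<bar>D j x\<bar> \<le> M" .
  qed
qed

text \<open>Tychonoff's theorem, read in the product topology that the function type
  carries.\<close>

lemma compact_box_functions:
  fixes b :: "'i \<Rightarrow> real"
  shows "compact {\<Phi> :: 'i \<Rightarrow> real. \<forall>z. \<Phi> z \<in> {- b z..b z}}"
proof -
  have "compactin (product_topology (\<lambda>_. euclidean) UNIV) (PiE UNIV (\<lambda>z. {- b z..b z}))"
    by (simp add: compactin_PiE)
  then show ?thesis
    by (simp add: euclidean_product_topology PiE_UNIV_domain Pi_def)
qed

text \<open>
  Families \<open>D 0, \<dots>, D n\<close> are points of a product of compact intervals indexed by \<open>(j, x)\<close>. Being a
  derivative family is not a closed condition there, but it follows from the first-order Taylor estimate
  with a uniform modulus, which is closed.
\<close>

lemma finite_extension_imp_extension: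
  fixes H :: "real \<Rightarrow> real"
  assumes contH: "continuous_on UNIV H"
    and T0: "finite T0" "card T0 = Suc n" "T0 \<subseteq> E"
    and fin: "\<And>S. finite S \<Longrightarrow> T0 \<subseteq> S \<Longrightarrow> S \<subseteq> E \<Longrightarrow> \<exists>D. deriv_family n D \<and> (\<forall>x\<in>S. D 0 x = f x) \<and>
      (\<forall>a b. a \<le> b \<longrightarrow> \<bar>D n b - D n a\<bar> \<le> H b - H a)"
  obtains D where "deriv_family n D" "\<And>x. x \<in> E \<Longrightarrow> D 0 x = f x"
    "\<And>a b. a \<le> b \<Longrightarrow> \<bar>D n b - D n a\<bar> \<le> H b - H a"
proof -
  have mono: "H a \<le> H b" if "a \<le> b" for a b
    using fin[OF T0(1) order_refl T0(3)] that by fastforce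
  obtain r where r: "T0 \<subseteq> {- r..r}"
  proof -
    obtain r where "\<forall>x\<in>T0. norm x \<le> r" using finite_imp_bounded[OF T0(1)] bounded_iff by blast
    then have "T0 \<subseteq> {- r..r}" by (auto simp: abs_le_iff minus_le_iff)
    then show ?thesis by (rule that)
  qed
  \<comment> \<open>The radius \<open>r + R\<close> keeps \<open>T0\<close> inside the interval
    while \<open>R\<close> grows to reach any given point.\<close>
  have "\<exists>M. 0 \<le> M \<and> (\<forall>D j x. deriv_family n D \<longrightarrow> (\<forall>x\<in>T0. D 0 x = f x) \<longrightarrow>
      (\<forall>a b. a \<le> b \<longrightarrow> \<bar>D n b - D n a\<bar> \<le> H b - H a) \<longrightarrow> j \<le> n \<longrightarrow> x \<in> {- (r + R)..r + R} \<longrightarrow> \<bar>D j x\<bar> \<le> M)"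
    if "0 \<le> R" for R
  proof -
    have "T0 \<subseteq> {- (r + R)..r + R}" using r that by force
    then show ?thesis
      by (rule deriv_family_bounded[OF T0(1,2), of _ f H]) (intro exI conjI allI impI, assumption, blast)
  qed
  then obtain M where M: "\<And>R. 0 \<le> R \<Longrightarrow> 0 \<le> M R" "\<And>R D j x. 0 \<le> R \<Longrightarrow> deriv_family n D \<Longrightarrow> (\<forall>x\<in>T0. D 0 x = f x) \<Longrightarrow>
      (\<forall>a b. a \<le> b \<longrightarrow> \<bar>D n b - D n a\<bar> \<le> H b - H a) \<Longrightarrow> j \<le> n \<Longrightarrow> x \<in> {- (r + R)..r + R} \<Longrightarrow> \<bar>D j x\<bar> \<le> M R"
    by metis
  define K1 :: "(nat \<times> real \<Rightarrow> real) set" where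
    "K1 = {\<Phi>. \<forall>a b. a \<le> b \<longrightarrow> \<bar>\<Phi> (n, b) - \<Phi> (n, a)\<bar> \<le> H b - H a}"
  \<comment> \<open>The remainder bound has one summand for each case: for \<open>j + 1 < n\<close>
    the derivative \<open>D (j + 1)\<close> has slope at most \<open>M R\<close>, and for
    \<open>j + 1 = n\<close> its increments are dominated by those of \<open>H\<close>.\<close>
  define K2 :: "(nat \<times> real \<Rightarrow> real) set" where
    "K2 = {\<Phi>. \<forall>j R x y. j < n \<and> 0 \<le> R \<and> x \<in> {- (r + R)..r + R} \<and> y \<in> {- (r + R)..r + R} \<longrightarrow>
       \<bar>\<Phi> (j, y) - \<Phi> (j, x) - (y - x) * \<Phi> (Suc j, x)\<bar> \<le> \<bar>y - x\<bar> * (M R * \<bar>y - x\<bar> + \<bar>H y - H x\<bar>)}"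
  define K3 :: "(nat \<times> real \<Rightarrow> real) set" where
    "K3 = {\<Phi>. \<forall>z. \<Phi> z \<in> {- M (\<bar>r\<bar> + \<bar>snd z\<bar>)..M (\<bar>r\<bar> + \<bar>snd z\<bar>)}}"
  note cont = continuous_on_product_coordinates
  have "closed K1"
    unfolding K1_def
    by (intro closed_Collect_all closed_Collect_imp open_Collect_const closed_Collect_le continuous_intros cont)
  moreover have "closed K2"
    unfolding K2_def
    by (intro closed_Collect_all closed_Collect_imp open_Collect_const closed_Collect_le continuous_intros cont)
  moreover have "compact K3" unfolding K3_def by (rule compact_box_functions)
  ultimately have compact: "compact (K1 \<inter> (K2 \<inter> K3))"
    by (intro closed_Int_compact)
  define P where "P x = {\<Phi> :: nat \<times> real \<Rightarrow> real. \<Phi> (0, x) = f x}" for x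
  have "(K1 \<inter> (K2 \<inter> K3)) \<inter> \<Inter>(P ` E) \<noteq> {}"
  proof (rule compact_imp_fip[OF compact])
    show "closed T" if "T \<in> P ` E" for T
      using that by (auto simp: P_def intro!: closed_Collect_eq continuous_intros cont)
    fix \<F> assume "finite \<F>" "\<F> \<subseteq> P ` E"
    then obtain S where S: "finite S" "S \<subseteq> E" "\<F> = P ` S" by (metis finite_subset_image)
    obtain D where D: "deriv_family n D" "\<forall>x\<in>S \<union> T0. D 0 x = f x"
      "\<forall>a b. a \<le> b \<longrightarrow> \<bar>D n b - D n a\<bar> \<le> H b - H a"
      using fin[of "S \<union> T0"] S T0 by auto
    then have DT: "\<forall>x\<in>T0. D 0 x = f x" by blast
    \<comment> \<open>Coordinates of order above \<open>n\<close> carry no information; the value 0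
      puts them into the box, since the bounds \<open>M\<close> are nonnegative.\<close>
    define \<Phi> where "\<Phi> z = (if fst z \<le> n then D (fst z) (snd z) else 0)" for z
    have "\<Phi> \<in> K1" using D(3) by (auto simp: K1_def \<Phi>_def)
    moreover have "\<Phi> \<in> K3"
    proof -
      have "\<Phi> z \<in> {- M (\<bar>r\<bar> + \<bar>snd z\<bar>)..M (\<bar>r\<bar> + \<bar>snd z\<bar>)}" for z
      proof -
        let ?R = "\<bar>r\<bar> + \<bar>snd z\<bar>"
        have "snd z \<in> {- (r + ?R)..r + ?R}" by auto
        then have "\<bar>\<Phi> z\<bar> \<le> M ?R"
          using M(1)[of ?R] M(2)[OF _ D(1) DT D(3), of ?R "fst z" "snd z"] by (simp add: \<Phi>_def)
        then show ?thesis by (simp add: abs_le_iff minus_le_iff)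
      qed
      then show ?thesis unfolding K3_def by blast
    qed
    moreover have "\<Phi> \<in> K2"
    proof -
      have "\<bar>D j y - D j x - (y - x) * D (Suc j) x\<bar> \<le> \<bar>y - x\<bar> * (M R * \<bar>y - x\<bar> + \<bar>H y - H x\<bar>)"
        if j: "j < n" and R: "0 \<le> R" and xy: "x \<in> {- (r + R)..r + R}" "y \<in> {- (r + R)..r + R}" for j R x y
      proof -
        have "\<exists>z. min x y \<le> z \<and> z \<le> max x y \<and> D j y - D j x = (y - x) * D (Suc j) z"
        proof (cases x y rule: linorder_cases)
          case less
          then obtain z where "x < z" "z < y" "D j y - D j x = (y - x) * D (Suc j) z"
            using MVT2[OF less, of "D j" "D (Suc j)"] deriv_familyD[OF D(1) j] by blast
          then show ?thesis by (intro exI[of _ z]) auto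
        next
          case greater
          then obtain z where "y < z" "z < x" "D j x - D j y = (x - y) * D (Suc j) z"
            using MVT2[OF greater, of "D j" "D (Suc j)"] deriv_familyD[OF D(1) j] by blast
          then show ?thesis by (intro exI[of _ z]) (auto simp: algebra_simps)
        qed auto
        then obtain z where z: "min x y \<le> z" "z \<le> max x y" "D j y - D j x = (y - x) * D (Suc j) z" by blast
        have M0: "0 \<le> M R" by (rule M(1)[OF R])
        have "\<bar>D (Suc j) z - D (Suc j) x\<bar> \<le> M R * \<bar>y - x\<bar> + \<bar>H y - H x\<bar>"
        proof (cases "Suc j = n")
          case True
          have "\<bar>D n z - D n x\<bar> \<le> \<bar>H z - H x\<bar>"
            using D(3) by (metis abs_ge_self abs_minus_commute linear order_trans)
          also have "\<dots> \<le> \<bar>H y - H x\<bar>"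
            using z(1,2) mono[of x z] mono[of z y] mono[of z x] mono[of y z] by (auto simp: min_def max_def split: if_splits)
          finally show ?thesis using True M0 by (simp add: add_increasing)
        next
          case False
          have "norm (D (Suc j) z - D (Suc j) x) \<le> M R * norm (z - x)"
          proof (rule field_differentiable_bound[OF convex_real_interval(5)[of "- (r + R)" "r + R"]])
            show "(D (Suc j) has_field_derivative D (Suc (Suc j)) t) (at t within {- (r + R)..r + R})" for t
              by (rule has_field_derivative_at_within[OF deriv_familyD[OF D(1)]]) (use False j in simp)
            show "norm (D (Suc (Suc j)) t) \<le> M R" if "t \<in> {- (r + R)..r + R}" for t
              using M(2)[OF R D(1) DT D(3) _ that] False j by simp
          qed (use z xy in auto)
          also have "\<dots> \<le> M R * \<bar>y - x\<bar>" using M0 z by (intro mult_left_mono) auto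
          finally show ?thesis by simp
        qed
        then have "\<bar>y - x\<bar> * \<bar>D (Suc j) z - D (Suc j) x\<bar> \<le> \<bar>y - x\<bar> * (M R * \<bar>y - x\<bar> + \<bar>H y - H x\<bar>)"
          by (rule mult_left_mono) simp
        moreover have "D j y - D j x - (y - x) * D (Suc j) x = (y - x) * (D (Suc j) z - D (Suc j) x)"
          unfolding z(3) by (simp add: right_diff_distrib)
        ultimately show ?thesis by (simp only: abs_mult)
      qed
      then show ?thesis by (auto simp: K2_def \<Phi>_def)
    qed
    moreover have "\<Phi> \<in> \<Inter>\<F>" using D(2) by (auto simp: S(3) P_def \<Phi>_def)
    ultimately show "(K1 \<inter> (K2 \<inter> K3)) \<inter> \<Inter>\<F> \<noteq> {}" by blast
  qed
  then obtain \<Phi> where \<Phi>: "\<Phi> \<in> K1" "\<Phi> \<in> K2" "\<And>x. x \<in> E \<Longrightarrow> \<Phi> (0, x) = f x"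
    by (auto simp: P_def)
  show ?thesis
  proof (rule that[of "\<lambda>j x. \<Phi> (j, x)"])
    show "\<Phi> (0, x) = f x" if "x \<in> E" for x by (rule \<Phi>(3)[OF that])
    show "\<bar>\<Phi> (n, b) - \<Phi> (n, a)\<bar> \<le> H b - H a" if "a \<le> b" for a b using \<Phi>(1) that by (simp add: K1_def)
    show "deriv_family n (\<lambda>j x. \<Phi> (j, x))"
      unfolding deriv_family_def
    proof (intro allI impI)
      fix j x assume j: "j < n"
      \<comment> \<open>With this \<open>R\<close> all points within distance 1 of \<open>x\<close>
        lie in the interval for which the estimate in \<open>K2\<close> is stated.\<close>
      define R where "R = \<bar>r\<bar> + \<bar>x\<bar> + 1"
      have est: "norm ((\<Phi> (j, y) - \<Phi> (j, x)) / (y - x) - \<Phi> (Suc j, x)) \<le> M R * \<bar>y - x\<bar> + \<bar>H y - H x\<bar>"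
        if "y \<noteq> x" "dist y x < 1" for y
      proof -
        have "\<bar>\<Phi> (j, y) - \<Phi> (j, x) - (y - x) * \<Phi> (Suc j, x)\<bar> \<le> \<bar>y - x\<bar> * (M R * \<bar>y - x\<bar> + \<bar>H y - H x\<bar>)"
        proof -
          have "0 \<le> R" "x \<in> {- (r + R)..r + R}" "y \<in> {- (r + R)..r + R}"
            using that by (auto simp: R_def dist_real_def)
          then show ?thesis using \<Phi>(2) j unfolding K2_def by blast
        qed
        moreover have "(\<Phi> (j, y) - \<Phi> (j, x)) / (y - x) - \<Phi> (Suc j, x) = (\<Phi> (j, y) - \<Phi> (j, x) - (y - x) * \<Phi> (Suc j, x)) / (y - x)"
          using that by (simp add: field_simps)
        ultimately show ?thesis using that by (simp add: divide_le_eq mult.commute)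
      qed
      have ev: "\<forall>\<^sub>F y in at x. norm ((\<Phi> (j, y) - \<Phi> (j, x)) / (y - x) - \<Phi> (Suc j, x)) \<le> M R * \<bar>y - x\<bar> + \<bar>H y - H x\<bar>"
        unfolding eventually_at using est by (intro exI[of _ 1]) auto
      have "(H \<longlongrightarrow> H x) (at x)" using contH by (simp add: continuous_on_eq_continuous_at isCont_def)
      then have "((\<lambda>y. M R * \<bar>y - x\<bar> + \<bar>H y - H x\<bar>) \<longlongrightarrow> M R * \<bar>x - x\<bar> + \<bar>H x - H x\<bar>) (at x)"
        by (intro tendsto_intros)
      then have "((\<lambda>y. (\<Phi> (j, y) - \<Phi> (j, x)) / (y - x) - \<Phi> (Suc j, x)) \<longlongrightarrow> 0) (at x)"
        by (intro Lim_null_comparison[OF ev]) simp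
      then show "((\<lambda>x. \<Phi> (j, x)) has_real_derivative \<Phi> (Suc j, x)) (at x)"
        unfolding has_field_derivative_iff by (rule LIM_zero_cancel)
    qed
  qed
qed

section \<open>The sharp maximal function\<close>

lemma ennpow_mono: "x \<le> y \<Longrightarrow> 0 \<le> q \<Longrightarrow> ennpow x q \<le> ennpow y q"
  by (cases x; cases y) (auto simp: ennpow_def top_unique intro!: ennreal_leI powr_mono2)

lemma ennpow_cmult: "0 < c \<Longrightarrow> ennpow (ennreal c * x) q = ennreal (c powr q) * ennpow x q"
  by (cases x) (auto simp: ennpow_def ennreal_mult[symmetric] powr_mult ennreal_mult_top enn2real_mult ennreal_mult_eq_top_iff)

lemma ennpow_less_top_iff: "ennpow x q < top \<longleftrightarrow> x < top"
  by (auto simp: ennpow_def less_top)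

lemma borel_measurable_ennpow [measurable]: "(\<lambda>c. ennpow c q) \<in> borel_measurable borel"
  unfolding ennpow_def[abs_def] by measurable

lemma Lp_norm_le_cmult:
  assumes "0 < q" "0 < K" "(\<integral>\<^sup>+x. ennpow (g x) q \<partial>lebesgue) \<le> ennreal K * (\<integral>\<^sup>+x. ennpow (h x) q \<partial>lebesgue)"
  shows "Lp_norm q g \<le> ennreal (K powr (1 / q)) * Lp_norm q h"
  unfolding Lp_norm_def ennpow_cmult[OF assms(2), symmetric]
  using assms by (intro ennpow_mono) auto

lemma sharp_maximal_upper:
  assumes "strict_mono_on {0..m} t" "t ` {0..m} \<subseteq> E"
  shows "ennreal (\<bar>divided_diff (m - 1) f (t ` {0..m - 1}) - divided_diff (m - 1) f (t ` {1..m})\<bar>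
                 / (\<bar>x - t 0\<bar> + \<bar>x - t m\<bar>)) \<le> sharp_maximal m E f x"
  unfolding sharp_maximal_def using assms by (intro SUP_upper2[of t]) auto

text \<open>A supremum of continuous functions is lower semicontinuous, however large the index set.
  The denominators never vanish because \<open>t 0 < t m\<close>.\<close>

lemma borel_measurable_sharp_maximal:
  assumes m: "1 \<le> m"
  shows "sharp_maximal m E f \<in> borel_measurable borel"
proof (rule borel_measurableI_greater)
  fix y :: ennreal
  have *: "open {x. y < ennreal (c / (\<bar>x - t 0\<bar> + \<bar>x - t m\<bar>))}"
    if "strict_mono_on {0..m} t" for c and t :: "nat \<Rightarrow> real"
  proof -
    have "t 0 < t m" using strict_mono_onD[OF that, of 0 m] m by simp
    then have "\<bar>x - t 0\<bar> + \<bar>x - t m\<bar> \<noteq> 0" for x by auto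
    then show ?thesis by (intro open_Collect_less continuous_on_ennreal continuous_intros) auto
  qed
  then have "open {x. y < sharp_maximal m E f x}"
    unfolding sharp_maximal_def less_SUP_iff Collect_bex_eq by (intro open_UN ballI *) simp
  then show "{x \<in> space borel. y < sharp_maximal m E f x} \<in> sets borel" by simp
qed

section \<open>Necessity: comparison with the maximal function\<close>

lemma sobolev_deriv_family:
  assumes "F \<in> sobolev m p"
  shows "deriv_family (m - 1) (\<lambda>j. (deriv ^^ j) F)"
  using assms unfolding deriv_family_def sobolev_def
  by (auto simp: DERIV_deriv_iff_field_differentiable)

lemma sharp_maximal_sobolev_bound:
  assumes p: "1 < p" and m: "1 \<le> m" and F: "F \<in> sobolev m p" "\<And>x. x \<in> E \<Longrightarrow> F x = f x"
  shows "Lp_norm p (sharp_maximal m E f) \<le>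
    ennreal ((20 * p * 4 powr (p - 1) / (p - 1)) powr (1 / p)) * sobolev_seminorm m p F"
proof -
  obtain n where n: "m = Suc n" using m by (cases m) auto
  define g where "g = (deriv ^^ n) F"
  have dg: "(deriv ^^ m) F = deriv g" by (simp add: n g_def)
  have ac: "locally_absolutely_continuous g" using F(1) by (simp add: sobolev_def n g_def)
  have "deriv g \<in> borel_measurable lebesgue" using F(1) by (simp add: sobolev_def in_Lp_real_def dg)
  \<comment> \<open>The maximal inequality is stated for Borel functions, while
    \<open>deriv g\<close> is only Lebesgue measurable; a Borel version has the same
    integrals.\<close>
  then obtain h' where h'[measurable]: "h' \<in> borel_measurable borel" "AE x in lborel. deriv g x = h' x"
    by (auto dest: completion_ex_borel_measurable_real)
  define h where "h x = ennreal \<bar>h' x\<bar>" for x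
  have [measurable]: "h \<in> borel_measurable borel" unfolding h_def by measurable
  have incr: "ennreal \<bar>g b - g a\<bar> \<le> (\<integral>\<^sup>+y. h y * indicator {u..v} y \<partial>lborel)"
    if "a \<in> {u..v}" "b \<in> {u..v}" for a b u v
  proof -
    have *: "ennreal \<bar>g b - g a\<bar> \<le> (\<integral>\<^sup>+y. h y * indicator {u..v} y \<partial>lborel)"
      if "u \<le> a" "a \<le> b" "b \<le> v" for a b
    proof -
      have I: "deriv g absolutely_integrable_on {a..b}" "(deriv g has_integral g b - g a) {a..b}"
        using locally_absolutely_continuous_AE_differentiable(2,3)[OF ac] that by auto
      then have abs: "(\<lambda>x. \<bar>deriv g x\<bar>) integrable_on {a..b}"
        by (simp add: absolutely_integrable_on_def)
      have "\<bar>g b - g a\<bar> = \<bar>integral {a..b} (deriv g)\<bar>" using I(2) by (simp add: integral_unique)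
      also have "\<dots> \<le> integral {a..b} (\<lambda>x. \<bar>deriv g x\<bar>)"
        using integral_norm_bound_integral[OF has_integral_integrable[OF I(2)] abs] by simp
      finally have "ennreal \<bar>g b - g a\<bar> \<le> ennreal (integral {a..b} (\<lambda>x. \<bar>deriv g x\<bar>))"
        by (rule ennreal_leI)
      also have "\<dots> = (\<integral>\<^sup>+x. ennreal \<bar>deriv g x\<bar> * indicator {a..b} x \<partial>lborel)"
        by (rule nn_integral_has_integral_lebesgue'[symmetric]) (use abs in \<open>auto simp: has_integral_integral\<close>)
      also have "\<dots> = (\<integral>\<^sup>+x. h x * indicator {a..b} x \<partial>lborel)"
        using h'(2) by (intro nn_integral_cong_AE, eventually_elim) (simp add: h_def)
      also have "\<dots> \<le> (\<integral>\<^sup>+x. h x * indicator {u..v} x \<partial>lborel)"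
        using that by (intro nn_integral_mono) (auto simp: indicator_def)
      finally show ?thesis .
    qed
    show ?thesis
      using *[of a b] *[of b a] that by (cases "a \<le> b") (auto simp: abs_minus_commute)
  qed
  have fam: "deriv_family n (\<lambda>j. (deriv ^^ j) F)" using sobolev_deriv_family[OF F(1)] n by simp
  have max: "\<exists>r>0. ennreal (\<alpha> * r) < (\<integral>\<^sup>+y. h y * indicator {x - r..x + r} y \<partial>lborel)"
    if \<alpha>: "0 < \<alpha>" "ennreal \<alpha> < sharp_maximal m E f x" for x \<alpha>
  proof -
    obtain t where t: "strict_mono_on {0..m} t" "t ` {0..m} \<subseteq> E"
      "ennreal \<alpha> < ennreal (\<bar>divided_diff n f (t ` {0..n}) - divided_diff n f (t ` {1..m})\<bar> / (\<bar>x - t 0\<bar> + \<bar>x - t m\<bar>))"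
      using \<alpha>(2) unfolding sharp_maximal_def less_SUP_iff by (auto simp: n)
    define r where "r = \<bar>x - t 0\<bar> + \<bar>x - t m\<bar>"
    have "t 0 < t m" using strict_mono_onD[OF t(1), of 0 m] m by simp
    then have r: "0 < r" by (auto simp: r_def)
    have inj: "inj_on t {0..m}" by (rule strict_mono_on_imp_inj_on[OF t(1)])
    have range: "t k \<in> {t 0..t m}" if "k \<le> m" for k
      using strict_mono_on_leD[OF t(1), of 0 k] strict_mono_on_leD[OF t(1), of k m] that by simp
    have card: "card (t ` {0..n}) = Suc n" "card (t ` {1..m}) = Suc n"
      using card_image[OF inj_on_subset[OF inj], of "{0..n}"] card_image[OF inj_on_subset[OF inj], of "{1..m}"]
      by (auto simp: n)
    have fF: "f y = (deriv ^^ 0) F y" if "y \<in> t ` {0..m}" for y using F(2) t(2) that by auto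
    obtain z1 where z1: "z1 \<in> {t 0..t m}" "divided_diff n f (t ` {0..n}) = g z1 / fact n"
      unfolding g_def by (rule divided_diff_mean_value[OF fam card(1), of "t 0" "t m" f])
        (use range fF n in auto)
    obtain z2 where z2: "z2 \<in> {t 0..t m}" "divided_diff n f (t ` {1..m}) = g z2 / fact n"
      unfolding g_def by (rule divided_diff_mean_value[OF fam card(2), of "t 0" "t m" f])
        (use range fF n in auto)
    have "\<alpha> < \<bar>g z1 / fact n - g z2 / fact n\<bar> / r"
      using t(3) \<alpha>(1) r unfolding r_def[symmetric] z1(2) z2(2) by (simp add: ennreal_less_iff)
    then have "\<alpha> * r < \<bar>g z1 / fact n - g z2 / fact n\<bar>" using r by (simp add: field_simps)
    also have "\<dots> = \<bar>g z1 - g z2\<bar> / fact n" by (simp add: diff_divide_distrib[symmetric])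
    also have "\<dots> \<le> \<bar>g z1 - g z2\<bar> / 1" by (intro divide_left_mono) auto
    finally have "ennreal (\<alpha> * r) < ennreal \<bar>g z1 - g z2\<bar>" using \<alpha>(1) r by (simp add: ennreal_less_iff)
    also have "\<dots> \<le> (\<integral>\<^sup>+y. h y * indicator {x - r..x + r} y \<partial>lborel)"
      using z1(1) z2(1) by (intro incr) (auto simp: r_def)
    finally show ?thesis using r by blast
  qed
  have "(\<integral>\<^sup>+x. ennpow (sharp_maximal m E f x) p \<partial>lborel) \<le>
      ennreal (20 * p * 4 powr (p - 1) / (p - 1)) * (\<integral>\<^sup>+x. ennpow (h x) p \<partial>lborel)"
    by (rule strong_type_maximal[OF p _ borel_measurable_sharp_maximal[OF m] max]) measurable
  also have "(\<integral>\<^sup>+x. ennpow (h x) p \<partial>lborel) = (\<integral>\<^sup>+x. ennpow (ennreal \<bar>deriv g x\<bar>) p \<partial>lborel)"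
    using h'(2) by (intro nn_integral_cong_AE, eventually_elim) (simp add: h_def)
  finally show ?thesis
    unfolding sobolev_seminorm_def dg using p by (intro Lp_norm_le_cmult) (auto simp: nn_integral_completion)
qed

section \<open>Functions whose increments are dominated by an L_p density\<close>

lemma le_add_powr:
  fixes u :: real
  assumes "0 \<le> u" "0 < A" "1 < p"
  shows "u \<le> A + A powr (1 - p) * u powr p"
proof (cases "u \<le> A")
  case False
  \<comment> \<open>Above the level \<open>A\<close> the quotient \<open>u / A\<close> exceeds 1, so
    multiplying by its power \<open>p - 1\<close> only increases \<open>u\<close>. This splitting is
    used in place of Hoelder's inequality.\<close>
  have "1 * u powr 1 \<le> (u / A) powr (p - 1) * u powr 1"
    using False assms by (intro mult_right_mono ge_one_powr_ge_zero) auto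
  also have "\<dots> = A powr (1 - p) * u powr p"
    using False assms by (simp add: powr_divide powr_diff powr_minus field_simps)
  finally show ?thesis using False assms by simp
qed (use assms in \<open>simp add: add_increasing2\<close>)

lemma continuous_primitive:
  fixes h :: "real \<Rightarrow> real"
  assumes h: "\<And>a b. h integrable_on {a..b}"
  obtains H where "continuous_on UNIV H" "\<And>a b. a \<le> b \<Longrightarrow> H b - H a = integral {a..b} h"
proof -
  define H where "H x = (if 0 \<le> x then integral {0..x} h else - integral {x..0} h)" for x
  have H: "H b - H a = integral {a..b} h" if "a \<le> b" for a b
    using that Henstock_Kurzweil_Integration.integral_combine[of a 0 b h] Henstock_Kurzweil_Integration.integral_combine[of 0 a b h]
      Henstock_Kurzweil_Integration.integral_combine[of a b 0 h] h
    by (auto simp: H_def)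
  have "isCont H x" for x
  proof -
    have "continuous_on {x - 1..x + 1} (\<lambda>y. H (x - 1) + integral {x - 1..y} h)"
      by (intro continuous_intros indefinite_integral_continuous_1 h)
    then have "continuous_on {x - 1..x + 1} H"
      by (rule continuous_on_eq) (use H[of "x - 1"] in force)
    then show ?thesis by (rule continuous_on_interior) auto
  qed
  then have "continuous_on UNIV H" by (simp add: continuous_at_imp_continuous_on)
  then show ?thesis using H by (rule that)
qed

lemma integrable_on_of_powr:
  fixes h :: "real \<Rightarrow> real"
  assumes h: "\<And>x. 0 \<le> h x" "h \<in> borel_measurable borel" and w: "(\<lambda>x. h x powr p) integrable_on UNIV" and p: "1 < p"
  shows "h integrable_on {a..b}"
proof (rule measurable_bounded_by_integrable_imp_integrable_real)
  show "h \<in> borel_measurable (lebesgue_on {a..b})" using h(2)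
    by (intro measurable_restrict_space1) (simp add: measurable_completion)
  have "(\<lambda>x. h x powr p) integrable_on {a..b}" by (rule integrable_on_subinterval[OF w]) simp
  then show "(\<lambda>x. 1 + 1 powr (1 - p) * h x powr p) integrable_on {a..b}"
    by (intro integrable_add integrable_on_cmult_right) auto
  show "\<bar>h x\<bar> \<le> 1 + 1 powr (1 - p) * h x powr p" for x using le_add_powr[of "h x" 1 p] h(1) p by simp
qed auto

text \<open>Over a division of total length below \<open>d\<close> the increments of
  \<open>g\<close> add up to at most \<open>K * (A * d + A powr (1 - p) * I)\<close>. As p > 1, a
  large \<open>A\<close> makes the second term small, and \<open>d\<close> is chosen
  afterwards.\<close>

lemma locally_absolutely_continuous_dominated:
  fixes h g :: "real \<Rightarrow> real"
  assumes h: "\<And>x. 0 \<le> h x" "\<And>a b. h integrable_on {a..b}" and w: "(\<lambda>x. h x powr p) integrable_on UNIV"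
    and p: "1 < p" and g: "\<And>a b. a \<le> b \<Longrightarrow> \<bar>g b - g a\<bar> \<le> K * integral {a..b} h" and K: "0 < K"
  shows "locally_absolutely_continuous g"
  unfolding locally_absolutely_continuous_def absolutely_continuous_on_def
proof (intro allI impI)
  fix a b e :: real assume e: "e > 0"
  define I where "I = integral UNIV (\<lambda>x. h x powr p)"
  have I: "0 \<le> I" unfolding I_def by (rule integral_nonneg[OF w]) simp
  \<comment> \<open>This solves \<open>A powr (1 - p) = e / (2 * K * (I + 1))\<close>. The
    \<open>+ 1\<close> covers \<open>I = 0\<close> and makes the second term strictly smaller than
    \<open>e / 2\<close>.\<close>
  define A where "A = ((2 * K * (I + 1)) / e) powr (1 / (p - 1))"
  have A: "0 < A" using e K I by (simp add: A_def)
  have "1 / (p - 1) * (1 - p) = - 1" using p by (simp add: divide_eq_eq)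
  then have "A powr (1 - p) = ((2 * K * (I + 1)) / e) powr (- 1)"
    unfolding A_def powr_powr by simp
  also have "\<dots> = e / (2 * K * (I + 1))" using e K I by (simp add: powr_minus)
  finally have AP: "A powr (1 - p) = e / (2 * K * (I + 1))" .
  have "K * (A powr (1 - p) * I) = e / 2 * (I / (I + 1))"
    unfolding AP using K I by (simp add: divide_simps)
  also have "\<dots> < e / 2 * 1" using e I by (intro mult_strict_left_mono) auto
  finally have A': "K * (A powr (1 - p) * I) < e / 2" by simp
  define d where "d = e / (2 * K * A)"
  show "\<exists>\<delta>>0. \<forall>D T. D division_of T \<longrightarrow> T \<subseteq> {a..b} \<longrightarrow> (\<Sum>K\<in>D. Sup K - Inf K) < \<delta> \<longrightarrow>
          (\<Sum>K\<in>D. \<bar>g (Sup K) - g (Inf K)\<bar>) < e"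
  proof (intro exI[of _ d] conjI allI impI)
    show "d > 0" using e K A by (simp add: d_def)
    fix D T assume D: "D division_of T" and len: "(\<Sum>K\<in>D. Sup K - Inf K) < d"
    have wi: "(\<lambda>x. h x powr p) integrable_on {u..v}" for u v by (rule integrable_on_subinterval[OF w]) simp
    have cwi: "(\<lambda>x. A powr (1 - p) * h x powr p) integrable_on {u..v}" for u v
      using integrable_cmul[OF wi, of "A powr (1 - p)"] by simp
    have wX: "(\<lambda>x. h x powr p) integrable_on X" if "X \<in> D" for X
      using division_of_real_intervalE[OF D that] wi by metis
    have "\<bar>g (Sup X) - g (Inf X)\<bar> \<le> K * (A * (Sup X - Inf X) + A powr (1 - p) * integral X (\<lambda>x. h x powr p))"
      if X: "X \<in> D" for X
    proof -
      obtain u v where uv: "X = {u..v}" "u \<le> v" by (rule division_of_real_intervalE[OF D X])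
      have "integral {u..v} h \<le> integral {u..v} (\<lambda>x. A + A powr (1 - p) * h x powr p)"
        using le_add_powr[OF h(1) A p] by (intro integral_le h(2) integrable_add cwi) auto
      also have "\<dots> = A * (v - u) + A powr (1 - p) * integral {u..v} (\<lambda>x. h x powr p)"
        using uv by (subst integral_add) (auto intro!: cwi)
      finally show ?thesis using g[OF uv(2)] K uv by (smt (verit) mult_left_mono cSup_atLeastAtMost cInf_atLeastAtMost)
    qed
    then have "(\<Sum>X\<in>D. \<bar>g (Sup X) - g (Inf X)\<bar>) \<le> (\<Sum>X\<in>D. K * (A * (Sup X - Inf X) + A powr (1 - p) * integral X (\<lambda>x. h x powr p)))"
      by (rule sum_mono)
    also have "\<dots> = K * (A * (\<Sum>X\<in>D. Sup X - Inf X)) + K * (A powr (1 - p) * (\<Sum>X\<in>D. integral X (\<lambda>x. h x powr p)))"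
      by (simp add: sum_distrib_left sum.distrib distrib_left)
    also have "(\<Sum>X\<in>D. integral X (\<lambda>x. h x powr p)) = integral T (\<lambda>x. h x powr p)"
      by (rule integral_combine_division_bottomup[OF D wX, symmetric])
    also have "integral T (\<lambda>x. h x powr p) \<le> I"
      unfolding I_def
      by (rule integral_subset_le[OF _ integrable_combine_division[OF D wX] w]) auto
    also have "K * (A * (\<Sum>X\<in>D. Sup X - Inf X)) < K * (A * d)" using K A len by simp
    also have "K * (A * d) = e / 2" using K A by (simp add: d_def)
    finally show "(\<Sum>X\<in>D. \<bar>g (Sup X) - g (Inf X)\<bar>) < e"
      using A' K A by simp
  qed
qed

lemma AE_deriv_le_dominated:
  fixes h g :: "real \<Rightarrow> real"
  assumes h: "\<And>a b. h integrable_on {a..b}" and ac: "locally_absolutely_continuous g"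
    and g: "\<And>a b. a \<le> b \<Longrightarrow> \<bar>g b - g a\<bar> \<le> K * integral {a..b} h"
  shows "AE x in lebesgue. \<bar>deriv g x\<bar> \<le> K * h x"
  using locally_absolutely_continuous_AE_differentiable(1)[OF ac] AE_integral_right_derivative[OF h]
proof eventually_elim
  case (elim x)
  have "((\<lambda>t. (g (x + t) - g x) / t) \<longlongrightarrow> deriv g x) (at_right 0)"
    using elim(1) unfolding DERIV_def by (rule tendsto_mono[rotated]) (simp add: at_le)
  then have 1: "((\<lambda>t. \<bar>(g (x + t) - g x) / t\<bar>) \<longlongrightarrow> \<bar>deriv g x\<bar>) (at_right 0)" by (rule tendsto_rabs)
  have 2: "((\<lambda>t. K * (integral {x..x + t} h / t)) \<longlongrightarrow> K * h x) (at_right 0)"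
    by (intro tendsto_intros elim(2))
  have 3: "\<forall>\<^sub>F t in at_right 0. \<bar>(g (x + t) - g x) / t\<bar> \<le> K * (integral {x..x + t} h / t)"
    unfolding eventually_at_right_field
    by (rule exI[of _ 1]) (use g[of x] in \<open>auto intro!: divide_right_mono\<close>)
  show ?case by (rule tendsto_le[OF _ 2 1 3]) simp
qed

lemma borel_measurable_deriv_locally_absolutely_continuous:
  assumes "locally_absolutely_continuous g"
  shows "deriv g \<in> borel_measurable lebesgue"
proof (rule borel_measurable_LIMSEQ_real)
  fix i :: nat
  show "(\<lambda>x. indicator {- real i..real i} x *\<^sub>R deriv g x) \<in> borel_measurable lebesgue"
    using locally_absolutely_continuous_AE_differentiable(2)[OF assms, of "- real i" "real i"]
    unfolding set_integrable_def by (rule borel_measurable_integrable)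
next
  fix x :: real
  obtain N where "\<bar>x\<bar> \<le> real N" using real_arch_simple by blast
  then have "\<forall>\<^sub>F i in sequentially. indicator {- real i..real i} x *\<^sub>R deriv g x = deriv g x"
    unfolding eventually_sequentially by (intro exI[of _ N]) (auto simp: indicator_def)
  then show "(\<lambda>i. indicator {- real i..real i} x *\<^sub>R deriv g x) \<longlonglongrightarrow> deriv g x"
    by (rule tendsto_eventually)
qed

section \<open>Sufficiency: the extension and its norm\<close>

lemma finite_set_enumeration:
  fixes S :: "real set"
  assumes "finite S" "card S = Suc N"
  obtains x where "strict_mono_on {0..N} x" "x ` {0..N} = S"
proof (rule that)
  let ?x = "\<lambda>i. sorted_list_of_set S ! i"
  have len: "length (sorted_list_of_set S) = Suc N" using assms by simp
  show "strict_mono_on {0..N} ?x"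
    using len strict_sorted_list_of_set[of S] by (intro strict_mono_onI) (auto simp: sorted_wrt_iff_nth_less)
  have "S = set (sorted_list_of_set S)" using assms by simp
  also have "\<dots> = ?x ` {0..N}" unfolding set_conv_nth len by (auto simp: less_Suc_eq_le)
  finally show "?x ` {0..N} = S" ..
qed

text \<open>For \<open>y\<close> between \<open>x i\<close> and \<open>x (i + m)\<close> the
  denominator in the sharp function equals \<open>x (i + m) - x i\<close>, so each term of the
  spline bound is at most a constant times the sharp function at \<open>y\<close>, and few terms are
  active there. That \<open>K\<close> is the same for all \<open>S\<close> permits the passage to
  infinite sets.\<close>

lemma finite_interpolation:
  assumes m: "1 \<le> m"
  obtains K where "0 < K" "\<And>E f S. finite S \<Longrightarrow> S \<subseteq> E \<Longrightarrow> m \<le> card S \<Longrightarrow>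
    \<exists>D. deriv_family m D \<and> (\<forall>x\<in>S. D 0 x = f x) \<and>
      (\<forall>y. sharp_maximal m E f y < top \<longrightarrow> \<bar>D m y\<bar> \<le> K * enn2real (sharp_maximal m E f y))"
proof -
  obtain C where C: "0 \<le> C" "\<And>n (x :: nat \<Rightarrow> real) f. m \<le> Suc n \<Longrightarrow> strict_mono_on {0..n} x \<Longrightarrow>
    \<exists>D. deriv_family m D \<and> (\<forall>k\<le>n. D 0 (x k) = f (x k)) \<and>
      (\<forall>y. \<bar>D m y\<bar> \<le> (\<Sum>i\<in>{i. i + m \<le> n}. if y \<in> {x i..x (i + m)} then
        C * (\<bar>divided_diff (m - 1) f (x ` {i..i + m - 1}) - divided_diff (m - 1) f (x ` {Suc i..i + m})\<bar> / (x (i + m) - x i)) else 0))"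
    using spline_interpolation[OF m] by blast
  \<comment> \<open>The factor \<open>m + 1\<close> counts the overlapping intervals at a point; the
    final \<open>+ 1\<close> keeps \<open>K\<close> positive when \<open>C = 0\<close>.\<close>
  define K where "K = (real m + 1) * C + 1"
  have K: "0 < K" "(real m + 1) * C \<le> K" using C(1) by (auto simp: K_def add_nonneg_pos)
  show ?thesis
  proof (rule that[OF K(1)])
    fix E S :: "real set" and f :: "real \<Rightarrow> real"
    assume S: "finite S" "S \<subseteq> E" "m \<le> card S"
    obtain N where N: "card S = Suc N" using S m by (cases "card S") auto
    obtain x where x: "strict_mono_on {0..N} x" "x ` {0..N} = S" by (rule finite_set_enumeration[OF S(1) N])
    define c where "c i = \<bar>divided_diff (m - 1) f (x ` {i..i + m - 1}) - divided_diff (m - 1) f (x ` {Suc i..i + m})\<bar> / (x (i + m) - x i)" for i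
    obtain D where D: "deriv_family m D" "\<forall>k\<le>N. D 0 (x k) = f (x k)"
      "\<And>y. \<bar>D m y\<bar> \<le> (\<Sum>i\<in>{i. i + m \<le> N}. if y \<in> {x i..x (i + m)} then C * c i else 0)"
      unfolding c_def using C(2)[OF _ x(1), of f] S(3) N by auto
    let ?s = "sharp_maximal m E f"
    have c: "c i \<le> enn2real (?s y)" if i: "i + m \<le> N" and y: "y \<in> {x i..x (i + m)}" and fin: "?s y < top" for i y
    proof -
      define t where "t k = x (i + k)" for k
      have "strict_mono_on {0..m} t"
        unfolding t_def using i by (intro strict_mono_onI strict_mono_onD[OF x(1)]) auto
      moreover have "t ` {0..m} \<subseteq> E"
      proof
        fix z assume "z \<in> t ` {0..m}"
        then obtain k where "k \<le> m" "z = x (i + k)" by (auto simp: t_def)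
        then have "z \<in> x ` {0..N}" using i by auto
        then show "z \<in> E" using x(2) S(2) by auto
      qed
      ultimately have "ennreal (\<bar>divided_diff (m - 1) f (t ` {0..m - 1}) - divided_diff (m - 1) f (t ` {1..m})\<bar>
                 / (\<bar>y - t 0\<bar> + \<bar>y - t m\<bar>)) \<le> ?s y"
        by (rule sharp_maximal_upper)
      moreover
      have image: "t ` {a..b} = x ` {a + i..b + i}" for a b
        unfolding image_add_atLeastAtMost[symmetric] image_image by (simp add: t_def)
      have "{0 + i..m - 1 + i} = {i..i + m - 1}" "{1 + i..m + i} = {Suc i..i + m}" using m by auto
      then have "t ` {0..m - 1} = x ` {i..i + m - 1}" "t ` {1..m} = x ` {Suc i..i + m}"
        by (simp_all only: image)
      moreover have "\<bar>y - t 0\<bar> + \<bar>y - t m\<bar> = x (i + m) - x i" using y by (auto simp: t_def)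
      ultimately have "ennreal (c i) \<le> ?s y" by (simp add: c_def)
      moreover have "0 \<le> c i" using y by (auto simp: c_def)
      ultimately show ?thesis using fin by (metis enn2real_ennreal enn2real_mono)
    qed
    have "\<bar>D m y\<bar> \<le> K * enn2real (?s y)" if fin: "?s y < top" for y
    proof -
      define A where "A = {i. i + m \<le> N \<and> y \<in> {x i..x (i + m)}}"
      have finA: "finite A" unfolding A_def by (rule finite_subset[of _ "{..N}"]) auto
      have cardA: "card A \<le> m + 1"
      proof (cases "A = {}")
        case False
        define i0 where "i0 = Min A"
        have i0: "i0 \<in> A" unfolding i0_def using finA False by (rule Min_in)
        \<comment> \<open>Two intervals that both contain \<open>y\<close> satisfy
          \<open>x i \<le> y \<le> x (i0 + m)\<close>. The count is \<open>m + 1\<close> and not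
          \<open>m\<close> because closed intervals may share an endpoint.\<close>
        have "A \<subseteq> {i0..i0 + m}"
        proof
          fix i assume i: "i \<in> A"
          have "i0 \<le> i" unfolding i0_def using finA i by (rule Min_le)
          moreover have "i \<le> i0 + m"
          proof (rule ccontr)
            assume "\<not> i \<le> i0 + m"
            then have "x (i0 + m) < x i" using i by (intro strict_mono_onD[OF x(1)]) (auto simp: A_def)
            then show False using i i0 by (auto simp: A_def)
          qed
          ultimately show "i \<in> {i0..i0 + m}" by simp
        qed
        then have "card A \<le> card {i0..i0 + m}" by (intro card_mono) auto
        then show ?thesis by simp
      qed simp
      have "\<bar>D m y\<bar> \<le> (\<Sum>i\<in>{i. i + m \<le> N}. if y \<in> {x i..x (i + m)} then C * c i else 0)" by (rule D(3))
      also have "\<dots> = (\<Sum>i\<in>A. C * c i)"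
        unfolding A_def by (rule sum.mono_neutral_cong_right) (auto intro: finite_subset[of _ "{..N}"])
      also have "\<dots> \<le> (\<Sum>i\<in>A. C * enn2real (?s y))"
        using C(1) c fin by (intro sum_mono mult_left_mono) (auto simp: A_def)
      also have "\<dots> = real (card A) * (C * enn2real (?s y))" by simp
      also have "\<dots> \<le> real (m + 1) * (C * enn2real (?s y))"
        using cardA C(1) by (intro mult_right_mono) auto
      also have "\<dots> = ((real m + 1) * C) * enn2real (?s y)" by simp
      also have "\<dots> \<le> K * enn2real (?s y)" using K(2) by (intro mult_right_mono) auto
      finally show ?thesis .
    qed
    moreover have "\<forall>z\<in>S. D 0 z = f z" using D(2) x(2) by force
    ultimately show "\<exists>D. deriv_family m D \<and> (\<forall>x\<in>S. D 0 x = f x) \<and>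
      (\<forall>y. sharp_maximal m E f y < top \<longrightarrow> \<bar>D m y\<bar> \<le> K * enn2real (sharp_maximal m E f y))"
      using D(1) by blast
  qed
qed

lemma sobolev_extension:
  assumes p: "1 < p" and m: "1 \<le> m"
  obtains K where "0 < K" "\<And>E f. infinite E \<or> card E > m \<Longrightarrow> in_Lp p (sharp_maximal m E f) \<Longrightarrow>
    \<exists>F\<in>sobolev m p. (\<forall>x\<in>E. F x = f x) \<and> sobolev_seminorm m p F \<le> ennreal K * Lp_norm p (sharp_maximal m E f)"
proof -
  obtain K where K: "0 < K" "\<And>E f S. finite S \<Longrightarrow> S \<subseteq> E \<Longrightarrow> m \<le> card S \<Longrightarrow>
    \<exists>D. deriv_family m D \<and> (\<forall>x\<in>S. D 0 x = f x) \<and>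
      (\<forall>y. sharp_maximal m E f y < top \<longrightarrow> \<bar>D m y\<bar> \<le> K * enn2real (sharp_maximal m E f y))"
    using finite_interpolation[OF m] by blast
  obtain n where n: "m = Suc n" using m by (cases m) auto
  show ?thesis
  proof (rule that[OF K(1)])
    fix E :: "real set" and f
    assume E: "infinite E \<or> card E > m" and Lp: "in_Lp p (sharp_maximal m E f)"
    let ?s = "sharp_maximal m E f"
    have [measurable]: "?s \<in> borel_measurable borel" by (rule borel_measurable_sharp_maximal[OF m])
    define h where "h x = enn2real (?s x)" for x
    have h0: "0 \<le> h x" for x by (simp add: h_def)
    have hm[measurable]: "h \<in> borel_measurable borel" unfolding h_def by measurable
    have int: "(\<integral>\<^sup>+x. ennpow (?s x) p \<partial>lborel) < top"
      using Lp by (simp add: in_Lp_def Lp_norm_def ennpow_less_top_iff nn_integral_completion)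
    then have "AE x in lborel. ennpow (?s x) p \<noteq> \<infinity>" by (intro nn_integral_PInf_AE) auto
    then have "AE x in lborel. ?s x < top"
      by eventually_elim (metis ennpow_less_top_iff infinity_ennreal_def less_top)
    then have fin: "AE x in lebesgue. ?s x < top" by (rule AE_completion)
    have "(\<integral>\<^sup>+x. ennreal (h x powr p) \<partial>lborel) \<le> (\<integral>\<^sup>+x. ennpow (?s x) p \<partial>lborel)"
      by (intro nn_integral_mono) (auto simp: ennpow_def h_def)
    then have "(\<integral>\<^sup>+x. ennreal (h x powr p) \<partial>lborel) < top" using int by (rule le_less_trans)
    then have w: "(\<lambda>x. h x powr p) integrable_on UNIV"
      by (intro nn_integral_integrable_on) auto
    have hi: "h integrable_on {a..b}" for a b by (rule integrable_on_of_powr[OF h0 hm w p])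
    obtain H0 where H0: "continuous_on UNIV H0" "\<And>a b. a \<le> b \<Longrightarrow> H0 b - H0 a = integral {a..b} h"
      using continuous_primitive[OF hi] by blast
    \<comment> \<open>The sharp function of the whole set \<open>E\<close> dominates those of its
      finite subsets, so \<open>H\<close> controls the increments of every finite interpolant at
      once.\<close>
    define H where "H x = K * H0 x" for x
    have H: "continuous_on UNIV H" "\<And>a b. a \<le> b \<Longrightarrow> H b - H a = K * integral {a..b} h"
      using H0 by (auto simp: H_def[abs_def] right_diff_distrib[symmetric] intro!: continuous_intros)
    obtain T0 where T0: "finite T0" "card T0 = Suc n" "T0 \<subseteq> E"
    proof (cases "finite E")
      case True
      then show ?thesis using that E n obtain_subset_with_card_n[of "Suc n" E] by (metis less_imp_le)
    next
      case False
      then show ?thesis using that infinite_arbitrarily_large[of E "Suc n"] by blast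
    qed
    have ext: "\<exists>D. deriv_family n D \<and> (\<forall>x\<in>S. D 0 x = f x) \<and> (\<forall>a b. a \<le> b \<longrightarrow> \<bar>D n b - D n a\<bar> \<le> H b - H a)"
      if S: "finite S" "T0 \<subseteq> S" "S \<subseteq> E" for S
    proof -
      have "m \<le> card S" using card_mono[OF S(1,2)] T0(2) n by simp
      then obtain D where D: "deriv_family m D" "\<forall>x\<in>S. D 0 x = f x"
        "\<And>y. ?s y < top \<Longrightarrow> \<bar>D m y\<bar> \<le> K * h y"
        using K(2)[OF S(1,3), of f] unfolding h_def by blast
      \<comment> \<open>The bound on \<open>D m\<close> is available only where the sharp function
        is finite; redefining \<open>D m\<close> as 0 on the null set \<open>N\<close> makes the
        comparison with \<open>K * h\<close> valid everywhere.\<close>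
      obtain N where N: "negligible N" "\<And>y. y \<notin> N \<Longrightarrow> ?s y < top"
        using fin unfolding eventually_ae_filter_negligible by auto
      have "\<bar>D n b - D n a\<bar> \<le> H b - H a" if "a \<le> b" for a b
      proof -
        \<comment> \<open>All that is known about \<open>D m\<close> is that it is a derivative; for
          the Henstock-Kurzweil integral this suffices.\<close>
        have "(D m has_integral D n b - D n a) {a..b}"
          using deriv_familyD[OF D(1), of n] n that
          by (intro fundamental_theorem_of_calculus)
             (auto simp flip: has_real_derivative_iff_has_vector_derivative intro: has_field_derivative_at_within)
        then have I: "((\<lambda>y. if y \<in> N then 0 else D m y) has_integral D n b - D n a) {a..b}"
          by (rule has_integral_spike[OF N(1), rotated]) auto
        have "norm (integral {a..b} (\<lambda>y. if y \<in> N then 0 else D m y)) \<le> integral {a..b} (\<lambda>y. K * h y)"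
          using D(3) N(2) K(1) h0
          by (intro integral_norm_bound_integral has_integral_integrable[OF I] integrable_on_cmult_right hi) (auto simp: hi)
        then show ?thesis using H(2)[OF that] integral_unique[OF I] by simp
      qed
      then show ?thesis using D n deriv_family_le[OF D(1), of n] by auto
    qed
    obtain D where D: "deriv_family n D" "\<And>x. x \<in> E \<Longrightarrow> D 0 x = f x"
      "\<And>a b. a \<le> b \<Longrightarrow> \<bar>D n b - D n a\<bar> \<le> H b - H a"
      using finite_extension_imp_extension[OF H(1) T0 ext] by blast
    define g where "g = D n"
    have g: "\<bar>g b - g a\<bar> \<le> K * integral {a..b} h" if "a \<le> b" for a b
      using D(3)[OF that] H(2)[OF that] by (simp add: g_def)
    have ac: "locally_absolutely_continuous g"
      by (rule locally_absolutely_continuous_dominated[OF h0 hi w p _ K(1)]) (rule g)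
    have dle: "AE x in lebesgue. \<bar>deriv g x\<bar> \<le> K * h x"
      by (rule AE_deriv_le_dominated[OF hi ac]) (rule g)
    have iter: "(deriv ^^ j) (D 0) = D j" if "j \<le> n" for j by (rule deriv_family_funpow_deriv[OF D(1) that])
    have dm: "(deriv ^^ m) (D 0) = deriv g" using iter[of n] by (simp add: n g_def)
    have "(\<integral>\<^sup>+x. ennpow (ennreal \<bar>deriv g x\<bar>) p \<partial>lebesgue) \<le> (\<integral>\<^sup>+x. ennreal (K powr p) * ennpow (?s x) p \<partial>lebesgue)"
    proof (rule nn_integral_mono_AE)
      show "AE x in lebesgue. ennpow (ennreal \<bar>deriv g x\<bar>) p \<le> ennreal (K powr p) * ennpow (?s x) p"
        using dle fin
      proof eventually_elim
        case (elim x)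
        have "ennreal \<bar>deriv g x\<bar> \<le> ennreal (K * h x)" using elim(1) by (rule ennreal_leI)
        also have "\<dots> = ennreal K * ?s x" using K(1) elim(2) by (simp add: h_def ennreal_mult)
        finally show ?case using p unfolding ennpow_cmult[OF K(1), symmetric] by (intro ennpow_mono) auto
      qed
    qed
    also have "\<dots> = ennreal (K powr p) * (\<integral>\<^sup>+x. ennpow (?s x) p \<partial>lebesgue)"
      unfolding nn_integral_completion by (rule nn_integral_cmult) measurable
    finally have "Lp_norm p (\<lambda>x. ennreal \<bar>deriv g x\<bar>) \<le> ennreal ((K powr p) powr (1 / p)) * Lp_norm p ?s"
      using p K(1) by (intro Lp_norm_le_cmult) auto
    then have norm: "Lp_norm p (\<lambda>x. ennreal \<bar>deriv g x\<bar>) \<le> ennreal K * Lp_norm p ?s"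
      using p K(1) by (simp add: powr_powr)
    also have "\<dots> < \<infinity>" using Lp by (auto simp: in_Lp_def ennreal_mult_less_top)
    finally have "in_Lp_real p (deriv g)"
      using borel_measurable_deriv_locally_absolutely_continuous[OF ac] by (simp add: in_Lp_real_def)
    moreover have "(deriv ^^ k) (D 0) field_differentiable at x" if "k < m - 1" for k x
      using iter[of k] deriv_familyD[OF D(1), of k x] that n field_differentiable_def by auto
    ultimately have "D 0 \<in> sobolev m p"
      using ac iter[of n] dm n by (auto simp: sobolev_def g_def)
    then show "\<exists>F\<in>sobolev m p. (\<forall>x\<in>E. F x = f x) \<and> sobolev_seminorm m p F \<le> ennreal K * Lp_norm p ?s"
      using D(2) norm unfolding sobolev_seminorm_def by (intro bexI[of _ "D 0"]) (simp_all add: dm)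
  qed
qed

theorem theorem1p8:
  fixes p :: real and m :: nat
  assumes "1 < p" and "1 \<le> m"
  shows "\<exists>C::real. C \<ge> 1 \<and>
    (\<forall>(E :: real set) (f :: real \<Rightarrow> real). closed E \<and> (infinite E \<or> card E > m) \<longrightarrow>
       (f \<in> trace_space m p E \<longleftrightarrow> in_Lp p (sharp_maximal m E f)) \<and>
       (f \<in> trace_space m p E \<longrightarrow>
          trace_seminorm m p E f \<le> ennreal C * Lp_norm p (sharp_maximal m E f) \<and>
          Lp_norm p (sharp_maximal m E f) \<le> ennreal C * trace_seminorm m p E f))"
proof -
  obtain K where K: "0 < K" "\<And>E f. infinite E \<or> card E > m \<Longrightarrow> in_Lp p (sharp_maximal m E f) \<Longrightarrow>
    \<exists>F\<in>sobolev m p. (\<forall>x\<in>E. F x = f x) \<and> sobolev_seminorm m p F \<le> ennreal K * Lp_norm p (sharp_maximal m E f)"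
    using sobolev_extension[OF assms] by blast
  define K' where "K' = (20 * p * 4 powr (p - 1) / (p - 1)) powr (1 / p)"
  define C where "C = max 1 (max K K')"
  have C: "1 \<le> C" "ennreal K \<le> ennreal C" "ennreal K' \<le> ennreal C" by (auto simp: C_def intro!: ennreal_leI)
  have upper: "Lp_norm p (sharp_maximal m E f) \<le> ennreal C * sobolev_seminorm m p F"
    if "F \<in> sobolev m p" "\<forall>x\<in>E. F x = f x" for E f F
  proof -
    have "Lp_norm p (sharp_maximal m E f) \<le> ennreal K' * sobolev_seminorm m p F"
      unfolding K'_def using that by (intro sharp_maximal_sobolev_bound assms) auto
    also have "\<dots> \<le> ennreal C * sobolev_seminorm m p F" using C(3) by (rule mult_right_mono) simp
    finally show ?thesis .
  qed
  show ?thesis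
  proof (intro exI[of _ C] conjI allI impI C(1))
    fix E :: "real set" and f :: "real \<Rightarrow> real"
    assume "closed E \<and> (infinite E \<or> card E > m)"
    then have E: "infinite E \<or> card E > m" by blast
    have imp: "in_Lp p (sharp_maximal m E f)" if tr: "f \<in> trace_space m p E"
    proof -
      obtain F where F: "F \<in> sobolev m p" "\<forall>x\<in>E. F x = f x" using tr by (auto simp: trace_space_def)
      have "sobolev_seminorm m p F < \<infinity>"
        using F(1) by (simp add: sobolev_def in_Lp_real_def sobolev_seminorm_def)
      then have "ennreal C * sobolev_seminorm m p F < \<infinity>" by (simp add: ennreal_mult_less_top)
      then have "Lp_norm p (sharp_maximal m E f) < \<infinity>" using upper[OF F] by (rule le_less_trans[rotated])
      then show ?thesis
        using borel_measurable_sharp_maximal[OF assms(2), of E f] by (simp add: in_Lp_def measurable_completion)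
    qed
    show "f \<in> trace_space m p E \<longleftrightarrow> in_Lp p (sharp_maximal m E f)"
      using imp K(2)[OF E, of f] unfolding trace_space_def by blast
    assume tr: "f \<in> trace_space m p E"
    obtain F where F: "F \<in> sobolev m p" "\<forall>x\<in>E. F x = f x"
      "sobolev_seminorm m p F \<le> ennreal K * Lp_norm p (sharp_maximal m E f)"
      using K(2)[OF E imp[OF tr]] by blast
    have "trace_seminorm m p E f \<le> sobolev_seminorm m p F"
      unfolding trace_seminorm_def using F(1,2) by (intro INF_lower) simp
    also have "\<dots> \<le> ennreal C * Lp_norm p (sharp_maximal m E f)"
      by (rule order_trans[OF F(3) mult_right_mono[OF C(2)]]) simp
    finally show "trace_seminorm m p E f \<le> ennreal C * Lp_norm p (sharp_maximal m E f)" .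
    \<comment> \<open>A lower bound for the infimum must be compared with the seminorms themselves,
      so the constant is first moved to the left as \<open>1 / C\<close> and multiplied back
      afterwards.\<close>
    have inv: "ennreal C * ennreal (1 / C) = 1" using C(1) by (simp add: ennreal_mult[symmetric])
    have "ennreal (1 / C) * Lp_norm p (sharp_maximal m E f) \<le> trace_seminorm m p E f"
      unfolding trace_seminorm_def
    proof (rule INF_greatest)
      fix F assume "F \<in> {F \<in> sobolev m p. \<forall>x\<in>E. F x = f x}"
      then have "ennreal (1 / C) * Lp_norm p (sharp_maximal m E f) \<le> ennreal (1 / C) * (ennreal C * sobolev_seminorm m p F)"
        by (intro mult_left_mono upper) auto
      then show "ennreal (1 / C) * Lp_norm p (sharp_maximal m E f) \<le> sobolev_seminorm m p F"
        using inv by (simp add: mult.assoc[symmetric] mult.commute)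
    qed
    then have "ennreal C * (ennreal (1 / C) * Lp_norm p (sharp_maximal m E f)) \<le> ennreal C * trace_seminorm m p E f"
      by (rule mult_left_mono) simp
    then show "Lp_norm p (sharp_maximal m E f) \<le> ennreal C * trace_seminorm m p E f"
      using inv by (simp add: mult.assoc[symmetric])
  qed
qed

end
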